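(* Let $\mathcal X\in\mathbb R^{n_1\times n_2\times n_3}$ with $\operatorname{rank}_t(\mathcal X)=\mathbf r$, let $n=\max\{n_1,n_2,n_3\}$, let $\Omega$ consist of $m$ indices sampled independently and uniformly with replacement from $\{1,\dots,n_1\}\times\{1,\dots,n_2\}\times\{1,\dots,n_3\}$, let $p=m/(n_1n_2n_3)$, and let $\mathcal T$ be the tangent space of $\mathcal M_{\mathbf r}$ at $\mathcal X$. Let $\mathcal X_l$ denote the iterates of the restarted tensor Riemannian conjugate gradient descent method with restart constants $k_1,k_2$. Suppose that $$\|R_\Omega\|\le\tfrac{10}{3}\beta\log n,\qquad \|P_{\mathcal T}-p^{-1}P_{\mathcal T}R_\Omega P_{\mathcal T}\|\le\epsilon_0,\qquad \frac{\|\mathcal X_l-\mathcal X\|_F}{\sigma_{\min}(\mathcal X)}\le\frac{3p^{1/2}\epsilon_0}{20\beta(1+\epsilon_0)\log n},$$ where $\beta>1$ and $\epsilon_0$ is a positive numerical constant satisfying $\gamma_1+\gamma_2<1$, with $$\gamma_1=\frac{18\epsilon_0-10k_1\epsilon_0(1+4\epsilon_0)}{(1-4\epsilon_0)-k_1(1+4\epsilon_0)}+\frac{4k_2\epsilon_0+k_1k_2}{1-4\epsilon_0},\qquad \gamma_2=\frac{8k_2\epsilon_0+2k_1k_2}{1-4\epsilon_0}.$$ Then $v_{cg}=\frac12\big(\gamma_1+\sqrt{\gamma_1^2+4\gamma_2}\big)<1$ and the iterates $\mathcal X_l$ satisfy $$\|\mathcal X_l-\mathcal X\|_F\le v_{cg}^{\,l}\,\|\mathcal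 X_0-\mathcal X\|_F.$$ When $k_1=k_2=0$, $v_{cg}$ is reduced to $\frac{18\epsilon_0}{1-4\epsilon_0}<1$. On the other hand, $\lim_{\epsilon_0\to0}(\gamma_1+\gamma_2)=3k_1k_2$. So if $k_1k_2<\frac13$, $\gamma_1+\gamma_2$ can be less than one when $\epsilon_0$ is small. In particular, when $k_1=0.1$ and $k_2=1$, a sufficient condition for $\gamma_1+\gamma_2<1$ is $\epsilon_0\le0.01$.
   Context: Tensor notation. $\widehat{\mathcal A}$ is obtained from $\mathcal A\in\mathbb R^{n_1\times n_2\times n_3}$ by applying the orthonormal DCT (a real orthogonal $n_3\times n_3$ matrix) to every tube $\mathcal A(i,j,:)$; $\widehat{\mathcal A}^{(k)}$ is the $k$-th frontal slice of $\widehat{\mathcal A}$; $\overline{\mathcal A}$ is the block diagonal matrix with blocks $\widehat{\mathcal A}^{(1)},\dots,\widehat{\mathcal A}^{(n_3)}$. The product $\mathcal A*\mathcal B$ and transpose $\mathcal A^T$ are defined slicewise: $\widehat{\mathcal A*\mathcal B}^{(k)}=\widehat{\mathcal A}^{(k)}\widehat{\mathcal B}^{(k)}$, $\widehat{\mathcal A^T}^{(k)}=(\widehat{\mathcal A}^{(k)})^T$. $\langle\cdot,\cdot\rangle$ and $\|\cdot\|_F$ are the entrywise Euclidean inner product and norm. $\operatorname{rank}_t(\mathcal A)=(\operatorname{rank}\widehat{\mathcal A}^{(1)},\dots,\operatorname{rank}\widehat{\mathcal A}^{(n_3)})$. $\sigma_{\min}(\mathcal A)$ is the smallest nonzero singular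 value of $\overline{\mathcal A}$. For a linear operator on tensors, $\|\cdot\|$ is the operator norm with respect to $\|\cdot\|_F$. Skinny t$_c$-SVD. If $\operatorname{rank}_t(\mathcal A)=\mathbf r=(r_1,\dots,r_{n_3})$ and $r=\max_kr_k$, then $\mathcal A=\mathcal U*\mathcal S*\mathcal V^T$ with $\mathcal U\in\mathbb R^{n_1\times r\times n_3}$, $\mathcal V\in\mathbb R^{n_2\times r\times n_3}$, $\mathcal U^T*\mathcal U=\mathcal V^T*\mathcal V=\mathcal I_{\mathbf r}$ (where $\widehat{\mathcal I_{\mathbf r}}^{(k)}=\mathrm{diag}(I_{r_k},0)$), $\mathcal S$ with diagonal frontal slices (slicewise SVD in the DCT domain). Manifold. $\mathcal M_{\mathbf r}=\{\mathcal Z\in\mathbb R^{n_1\times n_2\times n_3}:\operatorname{rank}_t(\mathcal Z)=\mathbf r\}$. The tangent space at a point with skinny t$_c$-SVD $\mathcal U*\mathcal S*\mathcal V^T$ is $\{\mathcal U*\mathcal Z_1^T+\mathcal Z_2*\mathcal V^T:\mathcal Z_1\in\mathbb R^{n_2\times r\times n_3},\mathcal Z_2\in\mathbb R^{n_1\times r\times n_3}\}$; the orthogonal projection onto it is $P(\mathcal A)=\mathcal U*\mathcal U^T*\mathcal A+\mathcal A*\mathcal V*\mathcal V^T-\mathcal U*\mathcal U^T*\mathcal A*\mathcal V*\mathcal V^T$. $H_{\mathbf r}$ is the t$_c$-SVD truncation: for each $k$ it replaces $\widehat{\mathcal W}^{(k)}$ by its truncated SVD of rank $r_k$. Sampling operator.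 $R_\Omega(\mathcal Z)=\sum_{(i,j,k)\in\Omega}\langle\mathcal E_{ijk},\mathcal Z\rangle\mathcal E_{ijk}$, the sum counted with multiplicity, where $\mathcal E_{ijk}$ has a $1$ at position $(i,j,k)$ and zeros elsewhere. Restarted tensor Riemannian conjugate gradient descent. Start from $\mathcal X_0=\mathcal U_0*\mathcal S_0*\mathcal V_0^T\in\mathcal M_{\mathbf r}$, $\beta_0=0$, $\mathcal Q_{-1}=0$. For $l=0,1,\dots$, with $\mathcal T_l$ the tangent space of $\mathcal M_{\mathbf r}$ at $\mathcal X_l$: (1) $\mathcal G_l=R_\Omega(\mathcal X-\mathcal X_l)$; (2) for $l\ge1$, $\beta_l=-\frac{\langle P_{\mathcal T_l}(\mathcal G_l),R_\Omega P_{\mathcal T_l}(\mathcal Q_{l-1})\rangle}{\langle P_{\mathcal T_l}(\mathcal Q_{l-1}),R_\Omega P_{\mathcal T_l}(\mathcal Q_{l-1})\rangle}$, except that $\beta_l$ is set to $0$ (restart) as long as either of the following conditions is violated: $$\frac{|\langle P_{\mathcal T_l}(\mathcal G_l),P_{\mathcal T_l}(\mathcal Q_{l-1})\rangle|}{\|P_{\mathcal T_l}(\mathcal G_l)\|_F\|P_{\mathcal T_l}(\mathcal Q_{l-1})\|_F}\le k_1,\qquad \|P_{\mathcal T_l}(\mathcal G_l)\|_F\le k_2\|P_{\mathcal T_l}(\mathcal Q_{l-1})\|_F;$$ (3) $\mathcal Q_l=P_{\mathcal T_l}(\mathcal G_l)+\beta_lP_{\mathcal T_l}(\mathcal Q_{l-1})$;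 (4) $\alpha_l=\frac{\langle P_{\mathcal T_l}(\mathcal G_l),P_{\mathcal T_l}(\mathcal Q_l)\rangle}{\langle P_{\mathcal T_l}(\mathcal Q_l),R_\Omega P_{\mathcal T_l}(\mathcal Q_l)\rangle}$; (5) $\mathcal W_l=\mathcal X_l+\alpha_l\mathcal Q_l$; (6) $\mathcal X_{l+1}=H_{\mathbf r}(\mathcal W_l)$.
   Formalization: The formal theorem adds k_1, k_2 ≥ 0, 1-4ε_0 > 0 and (1-4ε_0)-k_1(1+4ε_0) > 0, and k_1 ≠ 1 in the remarks on ε_0→0; as printed the claim fails, e.g. for k_1=1, k_2=0 with every index sampled once (v_cg=0). *)

theory Defs
  imports "HOL-Probability.Probability"
begin

section \<open>Tensors and the DCT\<close>

text \<open>
  A tensor of size \<open>n\<^sub>1 \<times> n\<^sub>2 \<times> n\<^sub>3\<close> is the vector of its frontal slices: \<open>A $ k $ i $ j\<close> is the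
  entry at position \<open>(i, j, k)\<close>, and \<open>A $ k\<close> is the \<open>k\<close>-th frontal slice.  With this encoding the
  library's \<open>inner\<close>, \<open>norm\<close> and \<open>onorm\<close> are the entrywise Euclidean inner product, the Frobenius
  norm, and the operator norm with respect to the Frobenius norm.  An index type that needs an
  enumeration \<open>0, 1, 2, \<dots>\<close> of its elements is a finite linear order.
\<close>

type_synonym ('a, 'b, 'c) tensor = "real ^ 'b ^ 'a ^ 'c"

definition index_pos :: "'i::{finite,linorder} \<Rightarrow> nat" where
  "index_pos k = card {j. j < k}"

text \<open>The orthonormal DCT(-II) matrix, with zero-based frequency \<open>k\<close> and sample \<open>j\<close>.\<close>

definition dct :: "real ^ ('c::{finite,linorder}) ^ ('c::{finite,linorder})" where
  "dct = (\<chi> k j. (if index_pos k = 0 then sqrt (1 / real CARD('c)) else sqrt (2 / real CARD('c)))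
            * cos ((2 * real (index_pos j) + 1) * real (index_pos k) * pi / (2 * real CARD('c))))"

definition tdct :: "('a::finite, 'b::finite, 'c::{finite,linorder}) tensor \<Rightarrow> ('a, 'b, 'c) tensor" where
  "tdct A = (\<chi> k. \<Sum>l\<in>UNIV. dct $ k $ l *\<^sub>R A $ l)"

text \<open>The inverse of \<open>tdct\<close> (see \<open>tidct_tdct\<close> and \<open>tdct_tidct\<close> below).\<close>

definition tidct :: "('a::finite, 'b::finite, 'c::{finite,linorder}) tensor \<Rightarrow> ('a, 'b, 'c) tensor" where
  "tidct A = (\<chi> k. \<Sum>l\<in>UNIV. transpose dct $ k $ l *\<^sub>R A $ l)"

definition tprod ::
  "('a::finite, 'd::finite, 'c::{finite,linorder}) tensor \<Rightarrow> ('d, 'b::finite, 'c) tensor \<Rightarrow> ('a, 'b, 'c) tensor"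
  (infixl "**\<^sub>t" 70) where
  "A **\<^sub>t B = tidct (\<chi> k. tdct A $ k ** tdct B $ k)"

definition ttranspose ::
  "('a::finite, 'b::finite, 'c::{finite,linorder}) tensor \<Rightarrow> ('b, 'a, 'c) tensor" where
  "ttranspose A = tidct (\<chi> k. transpose (tdct A $ k))"

definition trank :: "('a::finite, 'b::finite, 'c::{finite,linorder}) tensor \<Rightarrow> 'c \<Rightarrow> nat" where
  "trank A = (\<lambda>k. rank (tdct A $ k))"

definition block_diag ::
  "('a::finite, 'b::finite, 'c::{finite,linorder}) tensor \<Rightarrow> real ^ ('b \<times> 'c) ^ ('a \<times> 'c)" where
  "block_diag A = (\<chi> p q. if snd p = snd q then tdct A $ snd p $ fst p $ fst q else 0)"

text \<open>
  Square roots of the eigenvalues of \<open>M\<^sup>T M\<close>.  For a wide matrix this may contain an extra \<open>0\<close>;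
  only the nonzero elements are used.
\<close>

definition singular_values :: "real ^ 'n ^ 'm \<Rightarrow> real set" where
  "singular_values M = {s. 0 \<le> s \<and> (\<exists>v. v \<noteq> 0 \<and> (transpose M ** M) *v v = s\<^sup>2 *\<^sub>R v)}"

definition sigma_min :: "('a::finite, 'b::finite, 'c::{finite,linorder}) tensor \<Rightarrow> real" where
  "sigma_min A = Min (singular_values (block_diag A) - {0})"


section \<open>The t\<open>\<^sub>c\<close>-SVD, the manifold and its tangent spaces\<close>

definition trunc_id ::
  "('c::{finite,linorder} \<Rightarrow> nat) \<Rightarrow> ('r::{finite,linorder}, 'r, 'c) tensor" where
  "trunc_id r = tidct (\<chi> k i j. if i = j \<and> index_pos i < r k then 1 else 0)"

text \<open>
  The inner dimension \<open>max\<^sub>k r k\<close> is the cardinality of the index type \<open>'r\<close>.  Each DCT-domain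
  slice of \<open>S\<close> carries the singular values of that slice of \<open>X\<close> on its diagonal, in decreasing
  order and padded with zeros after position \<open>r k\<close>.
\<close>

definition skinny_tcsvd ::
  "('c \<Rightarrow> nat) \<Rightarrow> ('a::finite, 'b::finite, 'c::{finite,linorder}) tensor \<Rightarrow>
   ('a, 'r::{finite,linorder}, 'c) tensor \<Rightarrow> ('r, 'r, 'c) tensor \<Rightarrow> ('b, 'r, 'c) tensor \<Rightarrow> bool" where
  "skinny_tcsvd r X U S V \<longleftrightarrow>
     trank X = r \<and> CARD('r) = Max (range r) \<and>
     X = U **\<^sub>t S **\<^sub>t ttranspose V \<and>
     ttranspose U **\<^sub>t U = trunc_id r \<and> ttranspose V **\<^sub>t V = trunc_id r \<and>
     (\<forall>k i j. i \<noteq> j \<longrightarrow> tdct S $ k $ i $ j = 0) \<and>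
     (\<forall>k i. if index_pos i < r k then 0 < tdct S $ k $ i $ i else tdct S $ k $ i $ i = 0) \<and>
     (\<forall>k i j. i \<le> j \<longrightarrow> tdct S $ k $ j $ j \<le> tdct S $ k $ i $ i)"

definition tmanifold ::
  "('c \<Rightarrow> nat) \<Rightarrow> ('a::finite, 'b::finite, 'c::{finite,linorder}) tensor set" where
  "tmanifold r = {Z. trank Z = r}"

definition tangent_space ::
  "('a::finite, 'r::finite, 'c::{finite,linorder}) tensor \<Rightarrow> ('b::finite, 'r, 'c) tensor \<Rightarrow>
   ('a, 'b, 'c) tensor set" where
  "tangent_space U V = {U **\<^sub>t ttranspose Z\<^sub>1 + Z\<^sub>2 **\<^sub>t ttranspose V | Z\<^sub>1 Z\<^sub>2. True}"

text \<open>The orthogonal projection onto \<open>tangent_space U V\<close> (see \<open>tangent_proj_orthogonal\<close>).\<close>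

definition tangent_proj ::
  "('a::finite, 'r::finite, 'c::{finite,linorder}) tensor \<Rightarrow> ('b::finite, 'r, 'c) tensor \<Rightarrow>
   ('a, 'b, 'c) tensor \<Rightarrow> ('a, 'b, 'c) tensor" where
  "tangent_proj U V A =
     U **\<^sub>t ttranspose U **\<^sub>t A + A **\<^sub>t V **\<^sub>t ttranspose V
     - U **\<^sub>t ttranspose U **\<^sub>t A **\<^sub>t V **\<^sub>t ttranspose V"

definition outer_prod :: "real ^ 'm \<Rightarrow> real ^ 'n \<Rightarrow> real ^ 'n ^ 'm" where
  "outer_prod u v = (\<chi> i j. u $ i * v $ j)"

text \<open>An SVD written as a sum of \<open>d\<close> singular triples with nonincreasing singular values.\<close>

definition is_svd ::
  "real ^ 'n ^ 'm \<Rightarrow> nat \<Rightarrow> (nat \<Rightarrow> real ^ 'm) \<Rightarrow> (nat \<Rightarrow> real) \<Rightarrow> (nat \<Rightarrow> real ^ 'n) \<Rightarrow> bool" where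
  "is_svd W d u s v \<longleftrightarrow>
     (\<forall>i<d. \<forall>j<d. u i \<bullet> u j = (if i = j then 1 else 0)) \<and>
     (\<forall>i<d. \<forall>j<d. v i \<bullet> v j = (if i = j then 1 else 0)) \<and>
     (\<forall>i<d. 0 \<le> s i) \<and> (\<forall>i j. i \<le> j \<and> j < d \<longrightarrow> s j \<le> s i) \<and>
     W = (\<Sum>i<d. s i *\<^sub>R outer_prod (u i) (v i))"

text \<open>
  \<open>H\<^sub>r\<close> is not single-valued when singular values tie at the cut, so truncation is a relation:
  \<open>Z\<close> is obtained from some SVD of \<open>W\<close>.
\<close>

definition is_svd_truncation :: "nat \<Rightarrow> real ^ 'n ^ 'm \<Rightarrow> real ^ 'n ^ 'm \<Rightarrow> bool" where
  "is_svd_truncation k W Z \<longleftrightarrow>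
     (\<exists>d u s v. is_svd W d u s v \<and> Z = (\<Sum>i<min k d. s i *\<^sub>R outer_prod (u i) (v i)))"

definition is_tcsvd_truncation ::
  "('c \<Rightarrow> nat) \<Rightarrow> ('a::finite, 'b::finite, 'c::{finite,linorder}) tensor \<Rightarrow> ('a, 'b, 'c) tensor \<Rightarrow> bool" where
  "is_tcsvd_truncation r W Z \<longleftrightarrow> (\<forall>k. is_svd_truncation (r k) (tdct W $ k) (tdct Z $ k))"


section \<open>Sampling and the conjugate gradient method\<close>

definition unit_tensor :: "'a \<times> 'b \<times> 'c \<Rightarrow> ('a::finite, 'b::finite, 'c::finite) tensor" where
  "unit_tensor = (\<lambda>(i, j, k). axis k (axis i (axis j 1)))"

text \<open>\<open>\<Omega>\<close> is a list, so that an index sampled several times is counted with its multiplicity.\<close>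

definition sampling_op ::
  "('a \<times> 'b \<times> 'c) list \<Rightarrow> ('a::finite, 'b::finite, 'c::finite) tensor \<Rightarrow> ('a, 'b, 'c) tensor" where
  "sampling_op \<Omega> Z = (\<Sum>e\<leftarrow>\<Omega>. (unit_tensor e \<bullet> Z) *\<^sub>R unit_tensor e)"

text \<open>The law of \<open>m\<close> indices drawn independently and uniformly with replacement.\<close>

definition uniform_samples :: "nat \<Rightarrow> ('a::finite \<times> 'b::finite \<times> 'c::finite) list pmf" where
  "uniform_samples m = replicate_pmf m (pmf_of_set UNIV)"

text \<open>
  The restarted coefficient, with \<open>g\<close> the projected gradient, \<open>q\<close> the projected previous search
  direction and \<open>R\<close> the sampling operator.  When \<open>g\<close> or \<open>q\<close> vanishes, the value is \<open>0\<close> whichever way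
  the quotient in the first restart condition is read.
\<close>

definition cg_coeff ::
  "real \<Rightarrow> real \<Rightarrow> ('t::real_inner \<Rightarrow> 't) \<Rightarrow> 't \<Rightarrow> 't \<Rightarrow> real" where
  "cg_coeff k1 k2 R g q =
     (if \<bar>g \<bullet> q\<bar> / (norm g * norm q) \<le> k1 \<and> norm g \<le> k2 * norm q
      then - ((g \<bullet> R q) / (q \<bullet> R q)) else 0)"

text \<open>
  \<open>Xs l\<close>, with skinny t\<open>\<^sub>c\<close>-SVD \<open>Us l\<close>, \<open>Ss l\<close>, \<open>Vs l\<close>, and \<open>Qs l\<close> are the iterates and search directions
  of a run with data \<open>R (X - _)\<close>.  If the search direction vanishes then so does the step size
  (division by zero), and the method stays where it is.
\<close>

definition rtrcgd_run ::
  "('c \<Rightarrow> nat) \<Rightarrow> real \<Rightarrow> real \<Rightarrow> ('a \<times> 'b \<times> 'c) list \<Rightarrow>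
   ('a::finite, 'b::finite, 'c::{finite,linorder}) tensor \<Rightarrow>
   (nat \<Rightarrow> ('a, 'b, 'c) tensor) \<Rightarrow> (nat \<Rightarrow> ('a, 'r::{finite,linorder}, 'c) tensor) \<Rightarrow>
   (nat \<Rightarrow> ('r, 'r, 'c) tensor) \<Rightarrow> (nat \<Rightarrow> ('b, 'r, 'c) tensor) \<Rightarrow>
   (nat \<Rightarrow> ('a, 'b, 'c) tensor) \<Rightarrow> bool" where
  "rtrcgd_run r k1 k2 \<Omega> X Xs Us Ss Vs Qs \<longleftrightarrow>
     (\<forall>l. Xs l \<in> tmanifold r \<and> skinny_tcsvd r (Xs l) (Us l) (Ss l) (Vs l)) \<and>
     (\<forall>l. let R = sampling_op \<Omega>;
              P = tangent_proj (Us l) (Vs l);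
              g = P (R (X - Xs l));
              q = P (case l of 0 \<Rightarrow> 0 | Suc l' \<Rightarrow> Qs l');
              b = (if l = 0 then 0 else cg_coeff k1 k2 R g q);
              a = (g \<bullet> P (Qs l)) / (P (Qs l) \<bullet> R (P (Qs l)))
          in Qs l = g + b *\<^sub>R q \<and>
             is_tcsvd_truncation r (Xs l + a *\<^sub>R Qs l) (Xs (Suc l)))"

definition cg_gamma1 :: "real \<Rightarrow> real \<Rightarrow> real \<Rightarrow> real" where
  "cg_gamma1 k1 k2 \<epsilon> =
     (18 * \<epsilon> - 10 * k1 * \<epsilon> * (1 + 4 * \<epsilon>)) / ((1 - 4 * \<epsilon>) - k1 * (1 + 4 * \<epsilon>))
     + (4 * k2 * \<epsilon> + k1 * k2) / (1 - 4 * \<epsilon>)"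

definition cg_gamma2 :: "real \<Rightarrow> real \<Rightarrow> real \<Rightarrow> real" where
  "cg_gamma2 k1 k2 \<epsilon> = (8 * k2 * \<epsilon> + 2 * k1 * k2) / (1 - 4 * \<epsilon>)"

definition cg_rate :: "real \<Rightarrow> real \<Rightarrow> real \<Rightarrow> real" where
  "cg_rate k1 k2 \<epsilon> =
     (cg_gamma1 k1 k2 \<epsilon> + sqrt ((cg_gamma1 k1 k2 \<epsilon>)\<^sup>2 + 4 * cg_gamma2 k1 k2 \<epsilon>)) / 2"


section \<open>Adequacy of the encoding\<close>

lemma index_pos_bij: "bij_betw (index_pos :: 'i::{finite,linorder} \<Rightarrow> nat) UNIV {..<CARD('i)}"
proof -
  have m: "strict_mono (index_pos :: 'i \<Rightarrow> nat)"
    unfolding index_pos_def strict_mono_def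
    by (intro allI impI psubset_card_mono) (auto intro: less_trans)
  have "inj (index_pos :: 'i \<Rightarrow> nat)" using m by (rule strict_mono_imp_inj_on)
  moreover have "index_pos (k::'i) < CARD('i)" for k
    unfolding index_pos_def by (rule psubset_card_mono) auto
  ultimately show ?thesis
    by (intro bij_betw_imageI card_subset_eq) (auto simp: card_image)
qed

lemma sum_index_pos: "(\<Sum>j\<in>UNIV. f (index_pos (j::'i::{finite,linorder}))) = (\<Sum>j<CARD('i). f j)"
  using sum.reindex_bij_betw[OF index_pos_bij] by simp

lemma sum_cos_odd: "2 * sin x * (\<Sum>j<n. cos ((2 * real j + 1) * x)) = sin (2 * real n * x)"
proof (induction n)
  case (Suc n)
  have "2 * sin x * cos ((2 * real n + 1) * x) = sin (2 * real (Suc n) * x) - sin (2 * real n * x)"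
  proof -
    have "(2 * real (Suc n) * x - 2 * real n * x) / 2 = x"
      and "(2 * real (Suc n) * x + 2 * real n * x) / 2 = (2 * real n + 1) * x"
      by (simp_all add: algebra_simps add_divide_distrib)
    then show ?thesis
      using sin_diff_sin[of "2 * real (Suc n) * x" "2 * real n * x"] by simp
  qed
  with Suc show ?case by (simp add: algebra_simps)
qed simp

lemma sum_cos_odd_0:
  fixes h :: int
  assumes "h \<noteq> 0" "\<bar>h\<bar> < 2 * int n"
  shows "(\<Sum>j<n. cos ((2 * real j + 1) * (h * pi / (2 * real n)))) = 0"
proof -
  define x where "x = h * pi / (2 * real n)"
  have n: "0 < n" using assms by (cases n) auto
  have "sin x \<noteq> 0"
  proof
    assume "sin x = 0"
    then obtain i :: int where "x = of_int i * pi" by (auto simp: sin_zero_iff_int2)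
    then have "real_of_int h = real_of_int (2 * int n * i)"
      using n by (simp add: x_def field_simps)
    then have "h = 2 * int n * i" using of_int_eq_iff by blast
    with assms show False by (auto simp: abs_mult)
  qed
  moreover have "2 * real n * x = of_int h * pi" using n by (simp add: x_def)
  then have "sin (2 * real n * x) = 0" by (simp add: sin_zero_iff_int2)
  ultimately show ?thesis using sum_cos_odd[of x n] by (auto simp: x_def)
qed

lemma orthogonal_matrix_dct:
  "orthogonal_matrix (dct :: real ^ ('c::{finite,linorder}) ^ ('c::{finite,linorder}))"
proof -
  let ?D = "dct :: real ^ ('c::{finite,linorder}) ^ ('c::{finite,linorder})"
  let ?n = "CARD('c)"
  define c where "c = (\<lambda>k::nat. if k = 0 then sqrt (1 / real ?n) else sqrt (2 / real ?n))"
  have eq: "(\<Sum>j<?n. c k * cos ((2 * real j + 1) * real k * pi / (2 * real ?n))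
                   * (c l * cos ((2 * real j + 1) * real l * pi / (2 * real ?n))))
            = (if k = l then 1 else 0)" (is "?L = _")
    if kl: "k < ?n" "l < ?n" for k l
  proof -
    let ?C = "\<lambda>h::int. \<Sum>j<?n. cos ((2 * real j + 1) * (h * pi / (2 * real ?n)))"
    have "?L = c k * c l / 2 * (?C (int k - int l) + ?C (int k + int l))"
      unfolding sum_distrib_left sum.distrib[symmetric]
    proof (rule sum.cong, rule refl)
      fix j
      show "c k * cos ((2 * real j + 1) * real k * pi / (2 * real ?n))
                   * (c l * cos ((2 * real j + 1) * real l * pi / (2 * real ?n)))
          = c k * c l / 2 * (cos ((2 * real j + 1) * (real_of_int (int k - int l) * pi / (2 * real ?n)))
             + cos ((2 * real j + 1) * (real_of_int (int k + int l) * pi / (2 * real ?n))))"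
        using cos_times_cos[of "(2 * real j + 1) * real k * pi / (2 * real ?n)"
            "(2 * real j + 1) * real l * pi / (2 * real ?n)"]
        by (simp add: diff_divide_distrib add_divide_distrib algebra_simps)
    qed
    moreover have "?C 0 = real ?n" by simp
    moreover have "?C (int k + int l) = 0" if "k + l \<noteq> 0"
      using kl that by (intro sum_cos_odd_0) auto
    moreover have "?C (int k - int l) = 0" if "k \<noteq> l"
      using kl that by (intro sum_cos_odd_0) auto
    ultimately show ?thesis by (cases "k = l"; cases "k = 0") (auto simp: c_def)
  qed
  have "?D ** transpose dct = mat 1"
  proof -
    have "(?D ** transpose dct) $ k $ l = mat 1 $ k $ l" for k l
    proof -
      have "(?D ** transpose dct) $ k $ l
          = (if index_pos k = index_pos l then 1 else 0)"
        using index_pos_bij[where 'i = 'c]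
        by (subst eq[symmetric])
          (auto simp: matrix_matrix_mult_def transpose_def dct_def c_def bij_betw_def
             simp flip: sum_index_pos[where 'i = 'c])
      then show ?thesis
        using index_pos_bij[where 'i = 'c] by (auto simp: mat_def bij_betw_def inj_eq)
    qed
    then show ?thesis by (simp add: vec_eq_iff)
  qed
  then show ?thesis by (simp add: orthogonal_matrix_def matrix_left_right_inverse)
qed

lemma tdct_tidct [simp]:
  fixes A :: "('a::finite, 'b::finite, 'c::{finite,linorder}) tensor"
  shows "tdct (tidct A) = A"
proof -
  have "(\<Sum>l\<in>UNIV. dct $ k $ l *\<^sub>R (\<Sum>m\<in>UNIV. transpose dct $ l $ m *\<^sub>R A $ m)) = A $ k" for k
  proof -
    have "(\<Sum>l\<in>UNIV. dct $ k $ l *\<^sub>R (\<Sum>m\<in>UNIV. transpose dct $ l $ m *\<^sub>R A $ m))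
        = (\<Sum>m\<in>UNIV. (dct ** transpose dct) $ k $ m *\<^sub>R A $ m)"
      unfolding scaleR_sum_right
      by (subst sum.swap) (simp add: matrix_matrix_mult_def scaleR_sum_left)
    also have "\<dots> = A $ k"
      using orthogonal_matrix_dct[where 'c = 'c]
      by (simp add: orthogonal_matrix_def mat_def if_distrib[of "\<lambda>x. x *\<^sub>R _"] cong: if_cong)
    finally show ?thesis by simp
  qed
  then show ?thesis by (simp add: tdct_def tidct_def vec_eq_iff)
qed

lemma tidct_tdct [simp]:
  fixes A :: "('a::finite, 'b::finite, 'c::{finite,linorder}) tensor"
  shows "tidct (tdct A) = A"
proof -
  have "(\<Sum>l\<in>UNIV. transpose dct $ k $ l *\<^sub>R (\<Sum>m\<in>UNIV. dct $ l $ m *\<^sub>R A $ m)) = A $ k" for k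
  proof -
    have "(\<Sum>l\<in>UNIV. transpose dct $ k $ l *\<^sub>R (\<Sum>m\<in>UNIV. dct $ l $ m *\<^sub>R A $ m))
        = (\<Sum>m\<in>UNIV. (transpose dct ** dct) $ k $ m *\<^sub>R A $ m)"
      unfolding scaleR_sum_right
      by (subst sum.swap) (simp add: matrix_matrix_mult_def scaleR_sum_left)
    also have "\<dots> = A $ k"
      using orthogonal_matrix_dct[where 'c = 'c]
      by (simp add: orthogonal_matrix_def mat_def if_distrib[of "\<lambda>x. x *\<^sub>R _"] cong: if_cong)
    finally show ?thesis by simp
  qed
  then show ?thesis by (simp add: tdct_def tidct_def vec_eq_iff)
qed

lemma tdct_tprod: "tdct (A **\<^sub>t B) $ k = tdct A $ k ** tdct B $ k"
  by (simp add: tprod_def)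

lemma tdct_ttranspose: "tdct (ttranspose A) $ k = transpose (tdct A $ k)"
  by (simp add: ttranspose_def)

lemma tdct_trunc_id:
  "tdct (trunc_id r) $ k = (\<chi> i j. if i = j \<and> index_pos i < r k then 1 else 0)"
  by (simp add: trunc_id_def)

lemma tdct_add: "tdct (A + B) = tdct A + tdct B"
  by (simp add: tdct_def vec_eq_iff scaleR_add_right sum.distrib algebra_simps)

lemma tdct_diff: "tdct (A - B) = tdct A - tdct B"
  by (simp add: tdct_def vec_eq_iff sum_subtractf algebra_simps)

lemma tdct_eqI:
  assumes "\<And>k. tdct A $ k = tdct B $ k"
  shows "A = B"
  using assms tidct_tdct by (metis vec_eq_iff)

lemma tdct_inner:
  fixes A :: "('a::finite, 'b::finite, 'c::{finite,linorder}) tensor"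
  shows "tdct A \<bullet> tdct B = A \<bullet> B"
proof -
  have "tdct A \<bullet> tdct B = (\<Sum>k\<in>UNIV. tdct A $ k \<bullet> tdct B $ k)"
    by (rule inner_vec_def)
  also have "\<dots>
      = (\<Sum>k\<in>UNIV. \<Sum>l\<in>UNIV. \<Sum>m\<in>UNIV. dct $ k $ l * dct $ k $ m * (A $ l \<bullet> B $ m))"
  proof (rule sum.cong, rule refl)
    fix k :: 'c
    have "tdct A $ k \<bullet> tdct B $ k
        = (\<Sum>l\<in>UNIV. (dct $ k $ l *\<^sub>R A $ l) \<bullet> (\<Sum>m\<in>UNIV. dct $ k $ m *\<^sub>R B $ m))"
      by (simp only: tdct_def vec_lambda_beta inner_sum_left)
    also have "\<dots> = (\<Sum>l\<in>UNIV. \<Sum>m\<in>UNIV. dct $ k $ l * dct $ k $ m * (A $ l \<bullet> B $ m))"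
      by (simp add: inner_sum_right sum_distrib_left mult_ac)
    finally show "tdct A $ k \<bullet> tdct B $ k
        = (\<Sum>l\<in>UNIV. \<Sum>m\<in>UNIV. dct $ k $ l * dct $ k $ m * (A $ l \<bullet> B $ m))" .
  qed
  also have "\<dots> = (\<Sum>l\<in>UNIV. \<Sum>k\<in>UNIV. \<Sum>m\<in>UNIV. dct $ k $ l * dct $ k $ m * (A $ l \<bullet> B $ m))"
    by (rule sum.swap)
  also have "\<dots> = (\<Sum>l\<in>UNIV. \<Sum>m\<in>UNIV. \<Sum>k\<in>UNIV. dct $ k $ l * dct $ k $ m * (A $ l \<bullet> B $ m))"
    by (intro sum.cong refl sum.swap)
  also have "\<dots> = (\<Sum>l\<in>UNIV. \<Sum>m\<in>UNIV. (transpose dct ** dct) $ l $ m * (A $ l \<bullet> B $ m))"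
    by (simp add: matrix_matrix_mult_def transpose_def sum_distrib_right)
  also have "\<dots> = (\<Sum>l\<in>UNIV. A $ l \<bullet> B $ l)"
    using orthogonal_matrix_dct[where 'c = 'c]
    by (simp add: orthogonal_matrix_def mat_def if_distrib[of "\<lambda>x. x * _"] cong: if_cong)
  finally show ?thesis by (simp add: inner_vec_def[of A])
qed

lemma inner_matrix_mult_left: "(A ** B) \<bullet> C = B \<bullet> (transpose A ** C)"
  for A :: "real ^ 'd ^ 'a" and B :: "real ^ 'b ^ 'd"
proof -
  have "(A ** B) \<bullet> C = (\<Sum>i\<in>UNIV. \<Sum>j\<in>UNIV. \<Sum>d\<in>UNIV. A $ i $ d * B $ d $ j * C $ i $ j)"
    by (simp add: inner_vec_def matrix_matrix_mult_def sum_distrib_right)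
  also have "\<dots> = (\<Sum>i\<in>UNIV. \<Sum>d\<in>UNIV. \<Sum>j\<in>UNIV. A $ i $ d * B $ d $ j * C $ i $ j)"
    by (intro sum.cong refl sum.swap)
  also have "\<dots> = (\<Sum>d\<in>UNIV. \<Sum>i\<in>UNIV. \<Sum>j\<in>UNIV. A $ i $ d * B $ d $ j * C $ i $ j)"
    by (rule sum.swap)
  also have "\<dots> = (\<Sum>d\<in>UNIV. \<Sum>j\<in>UNIV. \<Sum>i\<in>UNIV. A $ i $ d * B $ d $ j * C $ i $ j)"
    by (intro sum.cong refl sum.swap)
  also have "\<dots> = B \<bullet> (transpose A ** C)"
    by (simp add: inner_vec_def matrix_matrix_mult_def transpose_def sum_distrib_left mult_ac)
  finally show ?thesis .
qed

lemma inner_transpose: "transpose A \<bullet> transpose B = A \<bullet> B" for A :: "real ^ 'b ^ 'a"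
  unfolding inner_vec_def transpose_def by (simp, rule sum.swap)

lemma inner_matrix_mult_right: "(A ** B) \<bullet> C = A \<bullet> (C ** transpose B)"
  for A :: "real ^ 'd ^ 'a" and B :: "real ^ 'b ^ 'd"
  using inner_matrix_mult_left[of "transpose B" "transpose A" "transpose C"]
  by (metis inner_transpose matrix_transpose_mul transpose_transpose)

lemma matrix_mult_diff_right: "A ** (B - C) = A ** B - A ** C" for A :: "real ^ 'd ^ 'a"
  by (simp add: matrix_matrix_mult_def vec_eq_iff right_diff_distrib sum_subtractf)

lemma matrix_mult_diff_left: "(B - C) ** A = B ** A - C ** A" for A :: "real ^ 'd ^ 'a"
  by (simp add: matrix_matrix_mult_def vec_eq_iff left_diff_distrib sum_subtractf)

lemma matrix_mult_add_left: "(B + C) ** A = B ** A + C ** A" for A :: "real ^ 'd ^ 'a"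
  by (simp add: matrix_matrix_mult_def vec_eq_iff distrib_right sum.distrib)

lemma partial_isometry:
  fixes U :: "real ^ 'r ^ 'a"
  assumes D: "transpose U ** U = D" and DD: "D ** D = D" and Dt: "transpose D = D"
  shows "transpose U ** (U ** transpose U) = transpose U"
proof -
  let ?M = "U ** D - U"
  have "?M \<bullet> ?M = (transpose U ** U ** D - transpose U ** U) \<bullet> (D - mat 1)"
  proof -
    have M: "?M = U ** (D - mat 1)" by (simp add: matrix_mult_diff_right)
    have "?M \<bullet> ?M = (D - mat 1) \<bullet> (transpose U ** ?M)"
      by (subst (1) M) (rule inner_matrix_mult_left)
    then show ?thesis by (simp add: matrix_mult_diff_right matrix_mul_assoc inner_commute)
  qed
  also have "\<dots> = 0" by (simp add: D DD)
  finally have "U ** D = U" by simp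
  then show ?thesis
    using D Dt by (metis matrix_mul_assoc matrix_transpose_mul)
qed

lemma tangent_proj_orthogonal:
  fixes U :: "('a::finite, 'r::{finite,linorder}, 'c::{finite,linorder}) tensor"
    and V :: "('b::finite, 'r, 'c) tensor"
  assumes U: "ttranspose U **\<^sub>t U = trunc_id r" and V: "ttranspose V **\<^sub>t V = trunc_id r"
  shows "tangent_proj U V A \<in> tangent_space U V"
    and "B \<in> tangent_space U V \<Longrightarrow> (A - tangent_proj U V A) \<bullet> B = 0"
proof -
  define Z1 where "Z1 = ttranspose (ttranspose U **\<^sub>t A)"
  define Z2 where "Z2 = A **\<^sub>t V - U **\<^sub>t ttranspose U **\<^sub>t A **\<^sub>t V"
  have "tangent_proj U V A = U **\<^sub>t ttranspose Z1 + Z2 **\<^sub>t ttranspose V"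
    by (rule tdct_eqI)
      (simp add: Z1_def Z2_def tangent_proj_def tdct_tprod tdct_ttranspose tdct_add tdct_diff
        matrix_mul_assoc matrix_mult_diff_left)
  then show "tangent_proj U V A \<in> tangent_space U V"
    unfolding tangent_space_def by blast
next
  assume "B \<in> tangent_space U V"
  then obtain Z1 Z2 where B: "B = U **\<^sub>t ttranspose Z1 + Z2 **\<^sub>t ttranspose V"
    unfolding tangent_space_def by blast
  let ?D = "\<lambda>k. (\<chi> i j. if i = j \<and> index_pos i < r k then 1 else 0) :: real ^ ('r::{finite,linorder}) ^ ('r::{finite,linorder})"
  have DD: "?D k ** ?D k = ?D k" "transpose (?D k) = ?D k" for k
  proof -
    have "(?D k ** ?D k) $ i $ j = ?D k $ i $ j" for i j
    proof -
      have "(?D k ** ?D k) $ i $ j = (\<Sum>l\<in>UNIV. if l = i then ?D k $ i $ j else 0)"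
        unfolding matrix_matrix_mult_def vec_lambda_beta by (rule sum.cong) auto
      then show ?thesis by simp
    qed
    then show "?D k ** ?D k = ?D k" by (simp only: vec_eq_iff simp_thms)
    show "transpose (?D k) = ?D k" by (auto simp: transpose_def vec_eq_iff)
  qed
  have "(tdct (A - tangent_proj U V A) $ k) \<bullet> (tdct B $ k) = 0" for k
  proof -
    define u v a where "u = tdct U $ k" and "v = tdct V $ k" and "a = tdct A $ k"
    define m where "m = tdct (A - tangent_proj U V A) $ k"
    have m: "m = a - (u ** transpose u ** a + a ** v ** transpose v
                      - u ** transpose u ** a ** v ** transpose v)"
      by (simp add: m_def u_def v_def a_def tangent_proj_def tdct_tprod tdct_ttranspose
          tdct_add tdct_diff)
    have uu: "transpose u ** u = ?D k" and vv: "transpose v ** v = ?D k"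
      using arg_cong[OF U, of "\<lambda>t. tdct t $ k"] arg_cong[OF V, of "\<lambda>t. tdct t $ k"]
      by (simp_all add: tdct_tprod tdct_ttranspose tdct_trunc_id u_def v_def)
    have u3: "transpose u ** u ** transpose u = transpose u"
      using partial_isometry[OF uu DD] by (simp add: matrix_mul_assoc)
    have v3: "transpose v ** v ** transpose v = transpose v"
      using partial_isometry[OF vv DD] by (simp add: matrix_mul_assoc)
    have v3': "v ** transpose v ** v = v"
      using arg_cong[OF v3, of transpose] by (simp add: matrix_transpose_mul matrix_mul_assoc)
    have um: "transpose u ** m = 0"
      by (simp add: m matrix_mult_diff_right matrix_add_ldistrib matrix_mul_assoc u3)
    have vm: "m ** v = 0"
    proof -
      have "x ** v ** transpose v ** v = x ** v" for x :: "real ^ 'b ^ 'a"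
        using v3' by (metis matrix_mul_assoc)
      then show ?thesis
        by (simp add: m matrix_mult_diff_left matrix_mult_add_left)
    qed
    have "tdct B $ k = u ** transpose (tdct Z1 $ k) + tdct Z2 $ k ** transpose v"
      by (simp add: B tdct_tprod tdct_ttranspose tdct_add u_def v_def)
    then have "tdct B $ k \<bullet> m = 0"
      using inner_matrix_mult_left[of u "transpose (tdct Z1 $ k)" m]
        inner_matrix_mult_right[of "tdct Z2 $ k" "transpose v" m]
      by (simp add: inner_add_left um vm)
    then show ?thesis by (simp add: m_def inner_commute)
  qed
  then show "(A - tangent_proj U V A) \<bullet> B = 0"
    by (subst tdct_inner[symmetric], subst inner_vec_def) simp
qed

end

theory Submission
  imports Defs
begin

text \<open>
  Write \<open>Y = X - X\<^sub>l\<close> and \<open>\<eta> = \<parallel>Y\<parallel> / \<sigma>\<^sub>m\<^sub>i\<^sub>n(X)\<close>.  In each DCT slice the column and row projections of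
  \<open>X\<close> and \<open>X\<^sub>l\<close> have equal rank and differ by at most \<open>\<eta>\<close>; hence the tangent projections \<open>P\<close> and \<open>P\<^sub>l\<close>
  differ by at most \<open>2\<eta>\<close>, and \<open>\<parallel>Y - P\<^sub>l Y\<parallel> \<le> \<eta> \<parallel>Y\<parallel>\<close>.  The smallness of \<open>\<eta>\<close> carries the near-isometry of
  \<open>p\<inverse>R\<close> from the range of \<open>P\<close> to that of \<open>P\<^sub>l\<close>, with \<open>4\<epsilon>\<^sub>0\<close> in place of \<open>\<epsilon>\<^sub>0\<close>.  Then \<open>p\<alpha>\<^sub>l\<close> is close to \<open>1\<close> because
  \<open>Q\<^sub>l\<close> is \<open>R\<close>-conjugate to the previous direction, and \<open>\<bar>\<beta>\<^sub>l\<bar> \<le> B := k\<^sub>2(k\<^sub>1 + 4\<epsilon>\<^sub>0)/(1 - 4\<epsilon>\<^sub>0)\<close> because of the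
  restart rule.  Since the truncation at most doubles the error, \<open>e\<^sub>l = \<parallel>X\<^sub>l - X\<parallel>\<close> satisfies
  \<open>e\<^sub>l\<^sub>+\<^sub>1 \<le> \<tau> e\<^sub>l + (2 + \<tau>) c\<^sub>l\<close> with \<open>c\<^sub>l = \<Sum>j<l. B^(l-j) e\<^sub>j\<close>; as \<open>\<gamma>\<^sub>1 = \<tau> + B\<close> and \<open>\<gamma>\<^sub>2 = 2B\<close>,
  this forces geometric decay at the positive root of \<open>v\<^sup>2 = \<gamma>\<^sub>1 v + \<gamma>\<^sub>2\<close>.
\<close>

subsection \<open>Projections and near-isometries\<close>

definition selfadjoint :: "('t::real_inner \<Rightarrow> 't) \<Rightarrow> bool" where
  "selfadjoint f \<longleftrightarrow> (\<forall>x y. f x \<bullet> y = x \<bullet> f y)"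

definition orth_proj :: "('t::real_inner \<Rightarrow> 't) \<Rightarrow> bool" where
  "orth_proj f \<longleftrightarrow> selfadjoint f \<and> (\<forall>x. f (f x) = f x)"

lemma selfadjointD: "selfadjoint f \<Longrightarrow> f x \<bullet> y = x \<bullet> f y"
  by (simp add: selfadjoint_def)

text \<open>The inner product is linear in the slot to which \<open>f\<close> is moved; testing
  against every \<open>z\<close> then determines the vectors.\<close>

lemma selfadjoint_linear:
  assumes "selfadjoint f" shows "linear f"
proof (rule linearI)
  fix x y :: 'a and c :: real
  have "f (x + y) \<bullet> z = (f x + f y) \<bullet> z" for z
    by (simp add: selfadjointD[OF assms] inner_add_left)
  then show "f (x + y) = f x + f y" by (metis vector_eq_rdot)
  have "f (c *\<^sub>R x) \<bullet> z = (c *\<^sub>R f x) \<bullet> z" for z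
    by (simp add: selfadjointD[OF assms])
  then show "f (c *\<^sub>R x) = c *\<^sub>R f x" by (metis vector_eq_rdot)
qed

lemma orth_projD:
  assumes "orth_proj f"
  shows "selfadjoint f" "linear f" "f (f x) = f x" "f x \<bullet> y = x \<bullet> f y"
  using assms selfadjoint_linear by (auto simp: orth_proj_def selfadjointD)

lemma orth_proj_pythagoras:
  assumes "orth_proj f" shows "(norm x)\<^sup>2 = (norm (f x))\<^sup>2 + (norm (x - f x))\<^sup>2"
proof -
  note f = orth_projD[OF assms]
  have "f x \<bullet> f x = f x \<bullet> x" by (metis f(3,4) inner_commute)
  then show ?thesis
    by (simp add: power2_norm_eq_inner inner_diff_left inner_diff_right inner_commute)
qed

lemma orth_proj_norm_le:
  assumes "orth_proj f" shows "norm (f x) \<le> norm x" "norm (x - f x) \<le> norm x"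
  using orth_proj_pythagoras[OF assms, of x] by (simp_all add: abs_le_square_iff[symmetric] power2_le_imp_le)

text \<open>Duality of operator norms: the bound on \<open>f\<close> is tested at
  \<open>g y\<close>, and one factor \<open>norm (g y)\<close> cancels.\<close>

lemma adjoint_norm_le:
  fixes f :: "'s::real_inner \<Rightarrow> 't::real_inner" and g :: "'t \<Rightarrow> 's"
  assumes adj: "\<And>x y. f x \<bullet> y = x \<bullet> g y" and le: "\<And>x. norm (f x) \<le> c * norm x"
    and c: "0 \<le> c"
  shows "norm (g y) \<le> c * norm y"
proof (cases "g y = 0")
  case True
  with c show ?thesis by simp
next
  case False
  have "norm (g y) * norm (g y) = f (g y) \<bullet> y"
    by (simp add: adj power2_norm_eq_inner[symmetric] power2_eq_square)
  also have "\<dots> \<le> norm (f (g y)) * norm y" by (rule norm_cauchy_schwarz)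
  also have "\<dots> \<le> (c * norm (g y)) * norm y" by (rule mult_right_mono[OF le]) simp
  finally have "norm (g y) * norm (g y) \<le> norm (g y) * (c * norm y)" by (simp add: mult_ac)
  with False show ?thesis by (simp add: mult_le_cancel_left)
qed

text \<open>Expand \<open>0 \<le> \<langle>z - Rz/\<rho>, R(z - Rz/\<rho>)\<rangle>\<close>.\<close>

lemma psd_norm_sq_le:
  assumes R: "selfadjoint R" and psd: "\<And>x. 0 \<le> x \<bullet> R x"
    and le: "\<And>x. norm (R x) \<le> \<rho> * norm x" and \<rho>: "0 < \<rho>"
  shows "(norm (R x))\<^sup>2 \<le> \<rho> * (x \<bullet> R x)"
proof -
  interpret linear R using R by (rule selfadjoint_linear)
  define t where "t = 1 / \<rho>"
  have "R x \<bullet> R (R x) \<le> norm (R x) * norm (R (R x))" by (rule norm_cauchy_schwarz)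
  also have "\<dots> \<le> norm (R x) * (\<rho> * norm (R x))" by (intro mult_left_mono le) simp
  finally have 1: "R x \<bullet> R (R x) \<le> \<rho> * (norm (R x))\<^sup>2" by (simp add: power2_eq_square mult_ac)
  have "0 \<le> (x - t *\<^sub>R R x) \<bullet> R (x - t *\<^sub>R R x)" by (rule psd)
  also have "\<dots> = x \<bullet> R x - 2 * t * (norm (R x))\<^sup>2 + t\<^sup>2 * (R x \<bullet> R (R x))"
  proof -
    have "x \<bullet> R (R x) = (norm (R x))\<^sup>2"
      using selfadjointD[OF R, of x "R x"] by (simp add: power2_norm_eq_inner)
    then show ?thesis
      by (simp add: diff scale inner_diff_left inner_diff_right inner_commute[of "R x" x]
          dot_square_norm power2_eq_square[of t] algebra_simps)
  qed
  also have "\<dots> \<le> x \<bullet> R x - 2 * t * (norm (R x))\<^sup>2 + t\<^sup>2 * (\<rho> * (norm (R x))\<^sup>2)"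
    using 1 by (intro add_left_mono mult_left_mono) auto
  also have "\<dots> = x \<bullet> R x - (norm (R x))\<^sup>2 / \<rho>"
    using \<rho> by (simp add: t_def power2_eq_square field_simps)
  finally show ?thesis using \<rho> by (simp add: field_simps)
qed

text \<open>Passing from P' to P in P' - P' R P' / p adds three terms, each small because P - P' has
  norm at most 2 \<eta>. The bound \<rho> for R alone is too weak in the mixed terms when p is
  small; on the range of P' the near-isometry and \<open>psd_norm_sq_le\<close> improve it to the
  order of sqrt (\<rho> p). The second conclusion controls how the part of the error outside the
  range of P enters the projected gradient.\<close>

lemma rip_transfer:
  fixes P P' R :: "'t::real_inner \<Rightarrow> 't"
  assumes P: "orth_proj P" and P': "orth_proj P'"
    and R: "selfadjoint R" and psd: "\<And>x. 0 \<le> x \<bullet> R x"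
    and R_le: "\<And>x. norm (R x) \<le> \<rho> * norm x" and \<rho>: "2 \<le> \<rho>"
    and p: "0 < p" "p \<le> \<rho>" and \<epsilon>: "0 < \<epsilon>" "\<epsilon> < 1 / 4"
    and rip: "\<And>x. norm (P' x - (1 / p) *\<^sub>R P' (R (P' x))) \<le> \<epsilon> * norm x"
    and near: "\<And>x. norm (P x - P' x) \<le> 2 * \<eta> * norm x"
    and \<eta>: "0 \<le> \<eta>" "\<eta> \<le> sqrt p * \<epsilon> / (2 * (1 + \<epsilon>) * \<rho>)"
  shows "norm (P x - (1 / p) *\<^sub>R P (R (P x))) \<le> 4 * \<epsilon> * norm x"
    and "\<exists>\<kappa>\<ge>0. (\<forall>x. norm (P (R x)) \<le> \<kappa> * norm x) \<and> \<kappa> * \<eta> \<le> 1 / 2 * \<epsilon> * p \<and> \<eta> \<le> 1 / 2 * \<epsilon>"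
proof -
  note pP = orth_projD[OF P] and pP' = orth_projD[OF P']
  interpret P: linear P by (rule pP)
  interpret P': linear P' by (rule pP')
  interpret R: linear R using R by (rule selfadjoint_linear)
  define h where "h = 2 * \<eta>"
  \<comment> \<open>A bound for R P': the square of norm (R P' x) is at most \<rho> <P' x, R P' x>,
    and the inner product is at most p (1 + \<epsilon>) norm(x)^2.\<close>
  define \<kappa> where "\<kappa> = sqrt (\<rho> * p * (1 + \<epsilon>))"
  have \<rho>0: "0 < \<rho>" using \<rho> by simp
  have h0: "0 \<le> h" using \<eta> by (simp add: h_def)
  have h_le: "h \<le> sqrt p * \<epsilon> / ((1 + \<epsilon>) * \<rho>)"
  proof -
    have eq: "2 * (sqrt p * \<epsilon> / (2 * (1 + \<epsilon>) * \<rho>)) = sqrt p * \<epsilon> / ((1 + \<epsilon>) * \<rho>)"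
      using \<epsilon> \<rho>0 by (simp add: divide_simps)
    show ?thesis using mult_left_mono[OF \<eta>(2), of 2] unfolding h_def eq by simp
  qed
  have h2: "h\<^sup>2 \<le> p * \<epsilon>\<^sup>2 / ((1 + \<epsilon>)\<^sup>2 * \<rho>\<^sup>2)"
    using power_mono[OF h_le h0, of 2] p by (simp add: power_divide power_mult_distrib)
  have "p * \<epsilon>\<^sup>2 / ((1 + \<epsilon>)\<^sup>2 * \<rho>\<^sup>2) \<le> p * \<epsilon>\<^sup>2 / (1 * \<rho>\<^sup>2)"
    using p \<epsilon> \<rho>0 by (intro divide_left_mono mult_right_mono) (auto simp: one_le_power)
  then have h2': "h\<^sup>2 \<le> p * \<epsilon>\<^sup>2 / \<rho>\<^sup>2" using h2 by simp
  have \<kappa>2: "\<kappa>\<^sup>2 = \<rho> * p * (1 + \<epsilon>)" using \<rho>0 p \<epsilon> by (simp add: \<kappa>_def)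
  have \<kappa>0: "0 \<le> \<kappa>" using \<rho>0 p \<epsilon> by (simp add: \<kappa>_def)
  \<comment> \<open>From p \<le> \<rho> and 2 \<le> \<rho> the square is at most \<epsilon>^2 / 2;
    the factor 3/4, here and in the next estimate, is a rational bound for sqrt (1/2).\<close>
  have hle: "h \<le> 3 / 4 * \<epsilon>"
  proof (rule power2_le_imp_le)
    have "h\<^sup>2 \<le> p * \<epsilon>\<^sup>2 / \<rho>\<^sup>2" by (rule h2')
    also have "\<dots> \<le> \<rho> * \<epsilon>\<^sup>2 / \<rho>\<^sup>2" using p \<rho>0 by (intro divide_right_mono mult_right_mono) auto
    also have "\<dots> = \<epsilon>\<^sup>2 / \<rho>" using \<rho>0 by (simp add: power2_eq_square)
    also have "\<dots> \<le> \<epsilon>\<^sup>2 / 2" using \<rho> by (intro divide_left_mono) auto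
    also have "\<dots> \<le> (3 / 4 * \<epsilon>)\<^sup>2" by (simp add: power2_eq_square)
    finally show "h\<^sup>2 \<le> (3 / 4 * \<epsilon>)\<^sup>2" .
  qed (use \<epsilon> in auto)
  have \<kappa>h: "\<kappa> * h \<le> 3 / 4 * \<epsilon> * p"
  proof (rule power2_le_imp_le)
    have "(\<kappa> * h)\<^sup>2 \<le> (\<rho> * p * (1 + \<epsilon>)) * (p * \<epsilon>\<^sup>2 / ((1 + \<epsilon>)\<^sup>2 * \<rho>\<^sup>2))"
      unfolding power_mult_distrib \<kappa>2 using h2 \<rho>0 p \<epsilon> by (intro mult_left_mono) auto
    also have "\<dots> = p\<^sup>2 * \<epsilon>\<^sup>2 / ((1 + \<epsilon>) * \<rho>)"
      using \<rho>0 \<epsilon> by (simp add: power2_eq_square)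
    also have "\<dots> \<le> p\<^sup>2 * \<epsilon>\<^sup>2 / (1 * 2)" using \<rho> \<epsilon>
      by (intro divide_left_mono mult_mono) auto
    also have "\<dots> \<le> (3 / 4 * \<epsilon> * p)\<^sup>2"
      using \<epsilon> p by (simp add: power2_eq_square)
    finally show "(\<kappa> * h)\<^sup>2 \<le> (3 / 4 * \<epsilon> * p)\<^sup>2" .
  qed (use \<epsilon> p in auto)
  have \<rho>h: "\<rho> * h * h \<le> 1 / 8 * \<epsilon> * p"
  proof -
    have "\<rho> * h * h \<le> \<rho> * (p * \<epsilon>\<^sup>2 / \<rho>\<^sup>2)"
      using mult_left_mono[OF h2', of \<rho>] \<rho>0 by (simp add: power2_eq_square mult_ac)
    also have "\<dots> = p * \<epsilon> * (\<epsilon> / \<rho>)" using \<rho>0 by (simp add: power2_eq_square)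
    also have "\<epsilon> / \<rho> \<le> 1 / 8" using \<rho> \<epsilon> by (simp add: field_simps)
    finally show ?thesis using p \<epsilon> by (simp add: mult_left_mono mult_ac)
  qed

  have RP': "norm (R (P' x)) \<le> \<kappa> * norm x" for x
  proof (rule power2_le_imp_le)
    have "norm ((1 / p) *\<^sub>R P' (R (P' x))) \<le> norm (P' x) + \<epsilon> * norm x"
      using rip[of x] norm_triangle_ineq4[of "P' x" "P' x - (1 / p) *\<^sub>R P' (R (P' x))"] by simp
    then have "norm (P' (R (P' x))) / p \<le> (1 + \<epsilon>) * norm x"
      using p orth_proj_norm_le(1)[OF P', of x] by (simp add: algebra_simps)
    then have "norm (P' (R (P' x))) \<le> p * ((1 + \<epsilon>) * norm x)"
      using p by (simp add: pos_divide_le_eq mult.commute)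
    then have 1: "norm x * norm (P' (R (P' x))) \<le> p * (1 + \<epsilon>) * (norm x)\<^sup>2"
      using mult_left_mono[of _ _ "norm x"] by (fastforce simp: power2_eq_square mult_ac)
    have "(norm (R (P' x)))\<^sup>2 \<le> \<rho> * (P' x \<bullet> R (P' x))"
      by (rule psd_norm_sq_le[OF R psd R_le \<rho>0])
    also have "P' x \<bullet> R (P' x) = x \<bullet> P' (R (P' x))" by (rule pP')
    also have "\<dots> \<le> norm x * norm (P' (R (P' x)))" by (rule norm_cauchy_schwarz)
    also note 1
    finally show "(norm (R (P' x)))\<^sup>2 \<le> (\<kappa> * norm x)\<^sup>2"
      using \<rho>0 by (simp add: power_mult_distrib \<kappa>2 mult_ac)
  qed (use \<kappa>0 in auto)
  have near': "norm (P x - P' x) \<le> h * norm x" for x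
    using near by (simp add: h_def)
  have RP: "norm (R (P x)) \<le> (\<kappa> + \<rho> * h) * norm x" for x
  proof -
    have "R (P x) = R (P' x) + R (P x - P' x)" by (simp add: R.diff)
    also have "norm \<dots> \<le> norm (R (P' x)) + norm (R (P x - P' x))" by (rule norm_triangle_ineq)
    also have "\<dots> \<le> \<kappa> * norm x + \<rho> * (h * norm x)"
      using \<rho>0 by (intro add_mono RP' order_trans[OF R_le] mult_left_mono near') auto
    finally show ?thesis by (simp add: algebra_simps)
  qed
  \<comment> \<open>P R is the adjoint of R P and inherits its norm bound.\<close>
  have PR: "norm (P (R x)) \<le> (\<kappa> + \<rho> * h) * norm x" for x
    by (rule adjoint_norm_le[of "\<lambda>x. R (P x)", OF _ RP])
       (use \<kappa>0 \<rho>0 h0 in \<open>simp_all add: selfadjointD[OF R] pP(4)\<close>)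

  have "P x - (1 / p) *\<^sub>R P (R (P x)) = (P x - P' x) + (P' x - (1 / p) *\<^sub>R P' (R (P' x)))
      - (1 / p) *\<^sub>R ((P (R (P' x)) - P' (R (P' x))) + P (R (P x - P' x)))"
    by (simp add: P.diff R.diff algebra_simps)
  also have "norm \<dots> \<le> norm (P x - P' x) + norm (P' x - (1 / p) *\<^sub>R P' (R (P' x)))
      + 1 / p * (norm (P (R (P' x)) - P' (R (P' x))) + norm (P (R (P x - P' x))))"
    using p by (intro order_trans[OF norm_triangle_ineq4] add_mono norm_triangle_ineq)
      (simp add: divide_right_mono norm_triangle_ineq)
  also have "\<dots> \<le> h * norm x + \<epsilon> * norm x
      + 1 / p * (h * (\<kappa> * norm x) + (\<kappa> + \<rho> * h) * (h * norm x))"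
    using p h0 \<kappa>0 \<rho>0
    by (intro add_mono near' rip mult_left_mono order_trans[OF near'] order_trans[OF PR] RP') auto
  also have "\<dots> = (h + \<epsilon> + 1 / p * (2 * (\<kappa> * h) + \<rho> * h * h)) * norm x"
    by (simp add: algebra_simps)
  also have "\<dots> \<le> 4 * \<epsilon> * norm x"
  proof (rule mult_right_mono)
    \<comment> \<open>The budget is 3/4 + 1 + 3/2 + 1/8 \<le> 4, with contributions from
      \<open>h\<close>, from the near-isometry of P', from twice \<kappa> h and from \<rho>
      h^2.\<close>
    have "1 / p * (2 * (\<kappa> * h) + \<rho> * h * h) \<le> 1 / p * (2 * (3 / 4 * \<epsilon> * p) + 1 / 8 * \<epsilon> * p)"
      using \<kappa>h \<rho>h p by (intro mult_left_mono add_mono) auto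
    also have "\<dots> = (3 / 2 + 1 / 8) * \<epsilon>" using p by (simp add: field_simps)
    finally have "\<epsilon> + 1 / p * (2 * (\<kappa> * h) + \<rho> * h * h) \<le> \<epsilon> + (3 / 2 + 1 / 8) * \<epsilon>"
      by (rule add_left_mono)
    note add_mono[OF hle this]
    also have "3 / 4 * \<epsilon> + (\<epsilon> + (3 / 2 + 1 / 8) * \<epsilon>) \<le> 4 * \<epsilon>" using \<epsilon> by simp
    finally show "h + \<epsilon> + 1 / p * (2 * (\<kappa> * h) + \<rho> * h * h) \<le> 4 * \<epsilon>"
      by (simp only: add.assoc)
  qed auto
  finally show "norm (P x - (1 / p) *\<^sub>R P (R (P x))) \<le> 4 * \<epsilon> * norm x" .
  show "\<exists>\<kappa>\<ge>0. (\<forall>x. norm (P (R x)) \<le> \<kappa> * norm x) \<and> \<kappa> * \<eta> \<le> 1 / 2 * \<epsilon> * p \<and> \<eta> \<le> 1 / 2 * \<epsilon>"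
  proof (intro exI[of _ "\<kappa> + \<rho> * h"] conjI allI PR)
    show "0 \<le> \<kappa> + \<rho> * h" using \<kappa>0 \<rho>0 h0 by simp
    have "(\<kappa> + \<rho> * h) * \<eta> = (\<kappa> * h + \<rho> * h * h) / 2" by (simp add: h_def algebra_simps)
    moreover have "0 < \<epsilon> * p" using \<epsilon> p by simp
    ultimately show "(\<kappa> + \<rho> * h) * \<eta> \<le> 1 / 2 * \<epsilon> * p" using \<kappa>h \<rho>h by (simp add: mult.assoc)
    show "\<eta> \<le> 1 / 2 * \<epsilon>" using hle \<epsilon> by (simp add: h_def)
  qed
qed

subsection \<open>Projection matrices of equal rank\<close>

lemma norm_vec_le:
  fixes A :: "'x::real_normed_vector ^ 'n" and B :: "'y::real_normed_vector ^ 'n"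
  assumes "\<And>k. norm (A $ k) \<le> c * norm (B $ k)" "0 \<le> c"
  shows "norm A \<le> c * norm B"
proof -
  have "norm A \<le> L2_set (\<lambda>k. c * norm (B $ k)) UNIV"
    unfolding norm_vec_def using assms by (intro L2_set_mono) auto
  also have "\<dots> = c * norm B"
    unfolding norm_vec_def using assms by (simp add: L2_set_right_distrib)
  finally show ?thesis .
qed

lemma norm_transpose: "norm (transpose A) = norm A" for A :: "real ^ 'b ^ 'a"
  by (simp add: norm_eq_sqrt_inner inner_transpose)

lemma inner_matrix_vector: "(A *v x) \<bullet> y = x \<bullet> (transpose A *v y)"
  for A :: "real ^ 'b ^ 'a"
  by (metis dot_lmul_matrix inner_commute transpose_matrix_vector)

lemma norm_matrix_vector_le: "norm (A *v x) \<le> norm A * norm x" for A :: "real ^ 'b ^ 'a"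
proof -
  have "norm ((A *v x) $ k) \<le> norm x * norm (A $ k)" for k
    using Cauchy_Schwarz_ineq2[of "A $ k" x] by (simp add: matrix_vector_mul_component mult.commute)
  then have "norm (A *v x) \<le> norm x * norm A"
    by (rule norm_vec_le) simp
  then show ?thesis by (simp add: mult.commute)
qed

text \<open>The left factor acts on each column separately, and the Frobenius norm is the Euclidean
  norm of the vector of column norms.\<close>

lemma norm_matrix_mult_le_left:
  fixes A :: "real ^ 'd ^ 'a" and B :: "real ^ 'b ^ 'd"
  assumes "\<And>x. norm (A *v x) \<le> c * norm x"
  shows "norm (A ** B) \<le> c * norm B"
proof -
  have "0 \<le> c * norm (axis undefined 1 :: real ^ 'd)"
    using assms norm_ge_zero order_trans by blast
  then have "0 \<le> c" by simp
  moreover have "transpose (A ** B) $ j = A *v (transpose B $ j)" for j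
    by (simp add: vec_eq_iff transpose_def matrix_matrix_mult_def matrix_vector_mult_def)
  ultimately have "norm (transpose (A ** B)) \<le> c * norm (transpose B)"
    using assms by (intro norm_vec_le) auto
  then show ?thesis by (simp add: norm_transpose)
qed

lemma norm_matrix_mult_le_right:
  fixes A :: "real ^ 'd ^ 'a" and B :: "real ^ 'b ^ 'd"
  assumes "\<And>x. norm (transpose B *v x) \<le> c * norm x"
  shows "norm (A ** B) \<le> c * norm A"
  using norm_matrix_mult_le_left[OF assms, of "transpose A"]
  by (metis norm_transpose matrix_transpose_mul)

lemma transpose_diff: "transpose (A - B) = transpose A - transpose B" for A :: "real ^ 'b ^ 'a"
  by (simp add: transpose_def vec_eq_iff)

lemma orth_proj_matrix:
  fixes u :: "real ^ 'a ^ 'a"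
  assumes "transpose u = u" "u ** u = u"
  shows "orth_proj ((*v) u)" "orth_proj ((*v) (mat 1 - u))"
proof -
  show "orth_proj ((*v) u)"
    unfolding orth_proj_def selfadjoint_def
    using assms by (metis inner_matrix_vector matrix_vector_mul_assoc)
  have "transpose (mat 1 - u) = mat 1 - u" using assms by (simp add: transpose_diff)
  moreover have "(mat 1 - u) ** (mat 1 - u) = mat 1 - u"
    using assms by (simp add: matrix_mult_diff_left matrix_mult_diff_right)
  ultimately show "orth_proj ((*v) (mat 1 - u))"
    unfolding orth_proj_def selfadjoint_def
    by (metis inner_matrix_vector matrix_vector_mul_assoc)
qed

text \<open>Since \<eta> < 1, \<open>w\<close> is injective on the range of \<open>u\<close>, and
  equal ranks make it onto the range of \<open>w\<close>. So each y in the range of \<open>w\<close>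
  is w z with z in the range of \<open>u\<close>; then norm(y)^2 = <u y, z>, and the bound on norm z
  forces norm (u y) to be large. Pythagoras turns this into the reverse gap.\<close>

lemma equal_rank_gap_symmetric:
  fixes u w :: "real ^ 'a ^ 'a"
  assumes u: "transpose u = u" "u ** u = u" and w: "transpose w = w" "w ** w = w"
    and rk: "rank u = rank w"
    and gap: "\<And>x. norm (((mat 1 - w) ** u) *v x) \<le> \<eta> * norm x" and \<eta>: "\<eta> < 1"
  shows "norm (((mat 1 - u) ** w) *v x) \<le> \<eta> * norm x"
proof -
  note pu = orth_projD[OF orth_proj_matrix(1)[OF u]] and pw = orth_projD[OF orth_proj_matrix(1)[OF w]]
  have \<eta>0: "0 \<le> \<eta>"
  proof -
    have "0 \<le> \<eta> * norm (axis undefined 1 :: real ^ 'a)"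
      using gap norm_ge_zero order_trans by blast
    then show ?thesis by simp
  qed
  define Ru Rw where "Ru = range ((*v) u)" and "Rw = range ((*v) w)"
  have diff: "(mat 1 - w) *v y = y - w *v y" "(mat 1 - u) *v y = y - u *v y" for y
    by (simp_all add: matrix_vector_mult_diff_rdistrib)
  have fixu: "u *v y = y" if "y \<in> Ru" for y
    using that pu(3) by (auto simp: Ru_def)
  have fixw: "w *v y = y" if "y \<in> Rw" for y
    using that pw(3) by (auto simp: Rw_def)
  have gap': "norm (y - w *v y) \<le> \<eta> * norm y" if "y \<in> Ru" for y
    using gap[of y] fixu[OF that] by (simp add: matrix_vector_mul_assoc[symmetric] diff)
  \<comment> \<open>By Pythagoras the gap becomes a lower bound for \<open>w\<close> on the range of
    \<open>u\<close>.\<close>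
  have low: "(1 - \<eta>\<^sup>2) * (norm y)\<^sup>2 \<le> (norm (w *v y))\<^sup>2" if "y \<in> Ru" for y
  proof -
    have "(norm (y - w *v y))\<^sup>2 \<le> \<eta>\<^sup>2 * (norm y)\<^sup>2"
      using power_mono[OF gap'[OF that], of 2] by (simp add: power_mult_distrib)
    then show ?thesis
      using orth_proj_pythagoras[OF orth_proj_matrix(1)[OF w], of y] by (simp add: algebra_simps)
  qed
  have \<eta>2: "0 < 1 - \<eta>\<^sup>2" using \<eta> \<eta>0 by (simp add: power_less_one_iff abs_square_less_1)
  have sub: "subspace Ru" "subspace Rw"
    unfolding Ru_def Rw_def using pu(2) pw(2) by (auto intro: linear_subspace_image)
  have "inj_on ((*v) w) Ru"
  proof (rule inj_onI)
    fix y z assume yz: "y \<in> Ru" "z \<in> Ru" "w *v y = w *v z"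
    then have "y - z \<in> Ru" using sub(1) by (auto intro: subspace_diff)
    moreover have "w *v (y - z) = 0" using yz by (simp add: matrix_vector_mult_diff_distrib)
    ultimately have "(1 - \<eta>\<^sup>2) * (norm (y - z))\<^sup>2 \<le> 0" using low[of "y - z"] by simp
    then show "y = z" using \<eta>2 by (simp add: mult_le_0_iff)
  qed
  then have "dim ((*v) w ` Ru) = dim Ru"
    using sub(1) pw(2) by (metis dim_image_eq span_eq_iff)
  also have "\<dots> = dim Rw" using rk by (simp add: Ru_def Rw_def rank_dim_range)
  finally have img: "(*v) w ` Ru = Rw"
    using sub pw(2) by (intro subspace_dim_equal linear_subspace_image) (auto simp: Rw_def)
  define y where "y = w *v x"
  have yR: "y \<in> Rw" by (simp add: y_def Rw_def)
  then obtain z where z: "z \<in> Ru" "y = w *v z" using img by blast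
  have wy: "w *v y = y" using fixw[OF yR] .
  have "(1 - \<eta>\<^sup>2) * (norm y)\<^sup>2 \<le> (norm (u *v y))\<^sup>2"
  proof (cases "z = 0")
    case True then show ?thesis using z by simp
  next
    case False
    have "(norm y)\<^sup>2 = y \<bullet> (w *v z)" using z by (simp add: power2_norm_eq_inner)
    also have "\<dots> = y \<bullet> z" using pw(4)[of y z] wy by simp
    also have "\<dots> = (u *v y) \<bullet> z" using pu(4)[of y z] fixu[OF z(1)] by simp
    also have "\<dots> \<le> norm (u *v y) * norm z" by (rule norm_cauchy_schwarz)
    finally have "((norm y)\<^sup>2)\<^sup>2 \<le> (norm (u *v y) * norm z)\<^sup>2" by (rule power_mono) simp
    then have 1: "(norm y)\<^sup>2 * (norm y)\<^sup>2 \<le> (norm (u *v y))\<^sup>2 * (norm z)\<^sup>2"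
      by (simp add: power2_eq_square mult_ac)
    have 2: "(1 - \<eta>\<^sup>2) * (norm z)\<^sup>2 \<le> (norm y)\<^sup>2" using low[OF z(1)] z by simp
    have "((1 - \<eta>\<^sup>2) * (norm y)\<^sup>2) * (norm z)\<^sup>2 = (norm y)\<^sup>2 * ((1 - \<eta>\<^sup>2) * (norm z)\<^sup>2)"
      by simp
    also have "\<dots> \<le> (norm y)\<^sup>2 * (norm y)\<^sup>2" by (rule mult_left_mono[OF 2]) simp
    also note 1
    finally show ?thesis using False by simp
  qed
  then have "(norm (y - u *v y))\<^sup>2 \<le> (\<eta> * norm y)\<^sup>2"
    using orth_proj_pythagoras[OF orth_proj_matrix(1)[OF u], of y]
    by (simp add: algebra_simps power_mult_distrib)
  then have "norm (y - u *v y) \<le> \<eta> * norm y"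
    by (rule power2_le_imp_le) (simp add: \<eta>0)
  also have "\<dots> \<le> \<eta> * norm x"
    using orth_proj_norm_le(1)[OF orth_proj_matrix(1)[OF w], of x] \<eta>0
    by (simp add: y_def mult_left_mono)
  finally show ?thesis by (simp add: y_def matrix_vector_mul_assoc[symmetric] diff)
qed

text \<open>Split u - w = u (1 - w) - (1 - u) w. The two terms have orthogonal values and act on the
  orthogonal parts x - w x and w x, so squares add and no factor 2 arises. The first term is the
  adjoint of the given gap, the second is the reverse gap.\<close>

lemma equal_rank_proj_diff:
  fixes u w :: "real ^ 'a ^ 'a"
  assumes u: "transpose u = u" "u ** u = u" and w: "transpose w = w" "w ** w = w"
    and rk: "rank u = rank w"
    and gap: "\<And>x. norm (((mat 1 - w) ** u) *v x) \<le> \<eta> * norm x" and \<eta>: "0 \<le> \<eta>" "\<eta> < 1"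
  shows "norm ((u - w) *v x) \<le> \<eta> * norm x"
proof -
  note ow = orth_proj_matrix(1)[OF w] and ou = orth_proj_matrix(1)[OF u]
  define a b where "a = u *v (x - w *v x)" and "b = w *v x - u *v (w *v x)"
  have ab: "(u - w) *v x = a - b"
    by (simp add: a_def b_def matrix_vector_mult_diff_rdistrib matrix_vector_mult_diff_distrib)
  have "u *v b = 0" using u(2)
    by (simp add: b_def matrix_vector_mult_diff_distrib matrix_vector_mul_assoc matrix_mul_assoc)
  then have "a \<bullet> b = 0"
    using orth_projD(4)[OF ou, of "x - w *v x" b] by (simp add: a_def)
  then have "(norm (a - b))\<^sup>2 = (norm a)\<^sup>2 + (norm b)\<^sup>2"
    by (simp add: power2_norm_eq_inner inner_diff_left inner_diff_right inner_commute)
  also have "\<dots> \<le> (\<eta> * norm (x - w *v x))\<^sup>2 + (\<eta> * norm (w *v x))\<^sup>2"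
  proof (intro add_mono power_mono)
    have "norm ((u ** (mat 1 - w)) *v y) \<le> \<eta> * norm y" for y
    proof (rule adjoint_norm_le[OF _ gap \<eta>(1)])
      fix y z
      have "transpose ((mat 1 - w) ** u) = u ** (mat 1 - w)"
        using u w by (simp add: matrix_transpose_mul transpose_diff)
      then show "(((mat 1 - w) ** u) *v y) \<bullet> z = y \<bullet> ((u ** (mat 1 - w)) *v z)"
        by (metis inner_matrix_vector)
    qed
    from this[of "x - w *v x"] show "norm a \<le> \<eta> * norm (x - w *v x)"
      using w by (simp add: a_def matrix_vector_mul_assoc[symmetric]
          matrix_vector_mult_diff_distrib matrix_vector_mult_diff_rdistrib)
        (simp add: matrix_vector_mul_assoc)
    show "norm b \<le> \<eta> * norm (w *v x)"
      using equal_rank_gap_symmetric[OF u w rk gap \<eta>(2), of "w *v x"] w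
      by (simp add: b_def matrix_vector_mul_assoc[symmetric] matrix_vector_mult_diff_rdistrib)
        (simp add: matrix_vector_mul_assoc)
  qed auto
  also have "\<dots> = (\<eta> * norm x)\<^sup>2"
    using orth_proj_pythagoras[OF ow, of x] by (simp add: power_mult_distrib algebra_simps)
  finally show ?thesis unfolding ab by (rule power2_le_imp_le) (simp add: \<eta>)
qed

subsection \<open>Singular value decompositions of slices\<close>

definition diag_mat :: "('n \<Rightarrow> real) \<Rightarrow> real ^ 'n ^ 'n" where
  "diag_mat f = (\<chi> i j. if i = j then f i else 0)"

lemma diag_mat_mult: "diag_mat f ** diag_mat g = diag_mat (\<lambda>i. f i * g i)"
proof -
  have "(\<Sum>k\<in>UNIV. (if i = k then f i else 0) * (if k = j then g k else 0))
      = (\<Sum>k\<in>UNIV. if k = i then (if i = j then f i * g i else 0) else 0)" for i j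
    by (rule sum.cong) auto
  then show ?thesis by (simp add: diag_mat_def matrix_matrix_mult_def vec_eq_iff)
qed

lemma transpose_diag_mat: "transpose (diag_mat f) = diag_mat f"
  by (auto simp: diag_mat_def transpose_def vec_eq_iff)

lemma diag_mat_vector: "(diag_mat f *v x) $ i = f i * x $ i"
proof -
  have "(\<Sum>j\<in>UNIV. (if i = j then f i else 0) * x $ j) = (\<Sum>j\<in>UNIV. if j = i then f i * x $ i else 0)"
    by (rule sum.cong) auto
  then show ?thesis by (simp add: diag_mat_def matrix_vector_mult_def)
qed

lemma norm_diag_mat_vector_le:
  assumes "\<And>i. \<bar>f i\<bar> \<le> c" shows "norm (diag_mat f *v x) \<le> c * norm x"
proof (rule norm_vec_le)
  show "norm ((diag_mat f *v x) $ i) \<le> c * norm (x $ i)" for i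
    using assms[of i] by (simp add: diag_mat_vector abs_mult mult_right_mono)
  show "0 \<le> c" using assms abs_ge_zero order_trans by blast
qed

text \<open>Slice \<open>k\<close> of \<open>trunc_id r\<close> in the DCT domain is
  \<open>coord_mat (r k)\<close>.\<close>

definition coord_mat :: "nat \<Rightarrow> real ^ ('r::{finite,linorder}) ^ ('r::{finite,linorder})" where
  "coord_mat n = diag_mat (\<lambda>i. if index_pos i < n then 1 else 0)"

text \<open>The trace is smaller than \<open>n\<close> when \<open>n\<close> exceeds the number of
  coordinates. This bound serves as the rank constraint in
  \<open>svd_truncation_optimal\<close>.\<close>

lemma trace_coord_mat_le: "trace (coord_mat n :: real ^ ('r::{finite,linorder}) ^ ('r::{finite,linorder})) \<le> real n"
proof -
  have "trace (coord_mat n :: real ^ ('r::{finite,linorder}) ^ ('r::{finite,linorder})) = (\<Sum>i\<in>UNIV. if index_pos (i::'r) < n then 1 else 0)"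
    by (simp add: trace_def coord_mat_def diag_mat_def)
  also have "\<dots> = (\<Sum>j<CARD('r). if j < n then 1 else 0)"
    by (rule sum_index_pos)
  also have "\<dots> = real (card {j. j < CARD('r) \<and> j < n})"
    by (simp add: sum.If_cases Int_def)
  also have "\<dots> \<le> real (card {..<n})"
    by (intro of_nat_mono card_mono) auto
  finally show ?thesis by simp
qed

text \<open>What \<open>skinny_tcsvd\<close> provides in one DCT slice. Transposition exchanges
  \<open>U\<close> and \<open>V\<close>, so each fact about column spaces also yields one about row
  spaces.\<close>

definition slice_svd ::
  "nat \<Rightarrow> real ^ 'b ^ 'a \<Rightarrow> real ^ ('r::{finite,linorder}) ^ 'a \<Rightarrow> real ^ ('r::{finite,linorder}) ^ ('r::{finite,linorder}) \<Rightarrow> real ^ ('r::{finite,linorder}) ^ 'b \<Rightarrow> bool" where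
  "slice_svd n x U S V \<longleftrightarrow>
     x = U ** S ** transpose V \<and> transpose U ** U = coord_mat n \<and> transpose V ** V = coord_mat n \<and>
     (\<exists>s. S = diag_mat s \<and> (\<forall>i. if index_pos i < n then 0 < s i else s i = 0))"

lemma slice_svd_transpose: "slice_svd n x U S V \<Longrightarrow> slice_svd n (transpose x) V S U"
  by (auto simp: slice_svd_def matrix_transpose_mul transpose_diag_mat matrix_mul_assoc)

lemma coord_mat_idem: "coord_mat n ** coord_mat n = coord_mat n"
  unfolding coord_mat_def diag_mat_mult by (rule arg_cong[of _ _ diag_mat]) auto

lemma partial_isometry_right:
  assumes "transpose U ** U = coord_mat n"
  shows "U ** transpose U ** U = U" "U ** coord_mat n = U"
proof -
  have "transpose U ** (U ** transpose U) = transpose U"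
    using assms by (rule partial_isometry) (simp_all add: coord_mat_idem, simp add: coord_mat_def transpose_diag_mat)
  from arg_cong[OF this, of transpose] show 1: "U ** transpose U ** U = U"
    by (simp add: matrix_transpose_mul)
  then show "U ** coord_mat n = U"
    by (simp add: assms[symmetric] matrix_mul_assoc)
qed

text \<open>\<open>transpose U ** U\<close> is a coordinate projection, of norm at most 1; the bound
  for the transpose follows by duality.\<close>

lemma norm_partial_isometry_le:
  assumes "transpose U ** U = coord_mat n"
  shows "norm (U *v z) \<le> norm z" "norm (transpose U *v w) \<le> norm w"
proof -
  have *: "norm (U *v z) \<le> 1 * norm z" for z
  proof -
    have "(norm (U *v z))\<^sup>2 = z \<bullet> (transpose U *v (U *v z))"
      unfolding power2_norm_eq_inner by (rule inner_matrix_vector)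
    also have "transpose U *v (U *v z) = coord_mat n *v z"
      unfolding matrix_vector_mul_assoc assms ..
    also have "z \<bullet> (coord_mat n *v z) \<le> norm z * norm (coord_mat n *v z)" by (rule norm_cauchy_schwarz)
    also have "\<dots> \<le> norm z * (1 * norm z)"
      unfolding coord_mat_def by (intro mult_left_mono norm_diag_mat_vector_le) auto
    finally have "(norm (U *v z))\<^sup>2 \<le> (norm z)\<^sup>2" by (simp add: power2_eq_square)
    then have "norm (U *v z) \<le> norm z" by (rule power2_le_imp_le) simp
    then show ?thesis by simp
  qed
  then show "norm (U *v z) \<le> norm z" by simp
  show "norm (transpose U *v w) \<le> norm w"
    using adjoint_norm_le[of "(*v) U" "(*v) (transpose U)" 1, OF inner_matrix_vector *] by simp
qed

text \<open>\<open>U ** transpose U\<close> is the orthogonal projection onto the column space of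
  \<open>x\<close>; cyclicity reduces its trace to that of \<open>coord_mat n\<close>.\<close>

lemma slice_svd_proj:
  assumes "slice_svd n x U S V"
  shows "transpose (U ** transpose U) = U ** transpose U"
    and "(U ** transpose U) ** (U ** transpose U) = U ** transpose U"
    and "(U ** transpose U) ** x = x"
    and "trace (U ** transpose U) \<le> real n"
proof -
  have U: "transpose U ** U = coord_mat n" and x: "x = U ** S ** transpose V"
    using assms unfolding slice_svd_def by blast+
  note U3 = partial_isometry_right(1)[OF U]
  show "transpose (U ** transpose U) = U ** transpose U" by (simp add: matrix_transpose_mul)
  show "(U ** transpose U) ** (U ** transpose U) = U ** transpose U"
    by (simp add: matrix_mul_assoc U3)
  show "(U ** transpose U) ** x = x" by (simp add: x matrix_mul_assoc U3)
  show "trace (U ** transpose U) \<le> real n"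
    by (subst trace_mul_sym) (simp add: U trace_coord_mat_le)
qed

text \<open>The witness is the Moore-Penrose pseudoinverse, which inverts the nonzero singular
  values. It lets a distance between matrices be turned into an angle between their column
  spaces.\<close>

lemma slice_svd_pinv:
  fixes U :: "real ^ ('r::{finite,linorder}) ^ 'a" and V :: "real ^ ('r::{finite,linorder}) ^ 'b"
  assumes svd: "slice_svd n x U S V" and \<sigma>: "0 < \<sigma>" "\<And>i. index_pos i < n \<Longrightarrow> \<sigma> \<le> S $ i $ i"
  obtains y where "x ** y = U ** transpose U" "\<And>w. norm (y *v w) \<le> norm w / \<sigma>"
proof -
  from svd have U: "transpose U ** U = coord_mat n" and V: "transpose V ** V = coord_mat n"
    and x: "x = U ** S ** transpose V"
    unfolding slice_svd_def by blast+
  from svd obtain s where s: "S = diag_mat s" "\<And>i. if index_pos i < n then 0 < s i else s i = 0"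
    unfolding slice_svd_def by blast
  define T where "T = diag_mat (\<lambda>i. if index_pos i < n then 1 / s i else 0)"
  have "s i * (if index_pos i < n then 1 / s i else 0) = (if index_pos i < n then 1 else 0)" for i
    using s(2)[of i] by auto
  then have ST: "S ** T = coord_mat n" by (simp only: s(1) T_def coord_mat_def diag_mat_mult)
  have "s i * (if index_pos i < n then 1 else 0) = s i" for i
    using s(2)[of i] by auto
  then have SD: "S ** coord_mat n = S" by (simp only: s(1) coord_mat_def diag_mat_mult)
  show thesis
  proof
    have "x ** (V ** T ** transpose U) = U ** S ** (transpose V ** V) ** T ** transpose U"
      by (simp add: x matrix_mul_assoc)
    also have "\<dots> = U ** (S ** coord_mat n ** T) ** transpose U"
      by (simp add: V matrix_mul_assoc)
    also have "\<dots> = U ** transpose U"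
      by (simp add: SD ST partial_isometry_right(2)[OF U])
    finally show "x ** (V ** T ** transpose U) = U ** transpose U" .
    fix w
    have "norm ((V ** T ** transpose U) *v w) = norm (V *v (T *v (transpose U *v w)))"
      by (simp only: matrix_vector_mul_assoc matrix_mul_assoc)
    also have "\<dots> \<le> norm (T *v (transpose U *v w))"
      by (rule norm_partial_isometry_le[OF V])
    also have "\<dots> \<le> 1 / \<sigma> * norm (transpose U *v w)"
      unfolding T_def
    proof (rule norm_diag_mat_vector_le)
      fix i
      show "\<bar>if index_pos i < n then 1 / s i else 0\<bar> \<le> 1 / \<sigma>"
        using \<sigma>(1) \<sigma>(2)[of i] by (cases "index_pos i < n") (auto simp: s(1) diag_mat_def intro!: divide_left_mono mult_pos_pos)
    qed
    also have "\<dots> \<le> 1 / \<sigma> * norm w"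
      using \<sigma>(1) by (intro mult_left_mono norm_partial_isometry_le[OF U]) auto
    finally show "norm ((V ** T ** transpose U) *v w) \<le> norm w / \<sigma>" by simp
  qed
qed

lemma slice_svd_rank:
  fixes U :: "real ^ ('r::{finite,linorder}) ^ 'a" and V :: "real ^ ('r::{finite,linorder}) ^ 'b"
  assumes svd: "slice_svd n x U S V"
  shows "rank (U ** transpose U) = rank x"
proof (rule antisym)
  obtain s where s: "S = diag_mat s" "\<And>i. if index_pos i < n then 0 < s i else s i = 0"
    using svd unfolding slice_svd_def by blast
  \<comment> \<open>The inserted 1 keeps the minimum meaningful when no coordinate lies below
    \<open>n\<close>.\<close>
  define \<sigma> where "\<sigma> = Min (insert 1 (s ` {i. index_pos i < n}))"
  have "0 < \<sigma>" unfolding \<sigma>_def using s(2) by (auto split: if_splits)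
  moreover have "\<sigma> \<le> S $ i $ i" if "index_pos i < n" for i
    unfolding \<sigma>_def using that by (auto simp: s(1) diag_mat_def)
  ultimately obtain y where "x ** y = U ** transpose U" using slice_svd_pinv[OF svd] by metis
  then show "rank (U ** transpose U) \<le> rank x" using rank_mul_le_left[of x y] by simp
  show "rank x \<le> rank (U ** transpose U)" 
    using rank_mul_le_left[of "U ** transpose U" x] by (simp add: slice_svd_proj(3)[OF svd])
qed

text \<open>A sine-theta estimate. With u = x y for the pseudoinverse y, and (1 - u') x' = 0, one
  has (1 - u') u = (1 - u') (x - x') y, of norm at most \<eta> \<sigma> / \<sigma>. Equality of
  ranks then gives the difference of the projections.\<close>

lemma slice_svd_gap:
  assumes svd: "slice_svd n x U S V" and svd': "slice_svd n' x' U' S' V'" and rk: "rank x = rank x'"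
    and \<sigma>: "0 < \<sigma>" "\<And>i. index_pos i < n \<Longrightarrow> \<sigma> \<le> S $ i $ i"
    and near: "norm (x - x') \<le> \<eta> * \<sigma>" and \<eta>: "0 \<le> \<eta>" "\<eta> < 1"
  shows "norm (((mat 1 - U' ** transpose U') ** (U ** transpose U)) *v w) \<le> \<eta> * norm w"
    and "norm ((U ** transpose U - U' ** transpose U') *v w) \<le> \<eta> * norm w"
proof -
  define u u' where "u = U ** transpose U" and "u' = U' ** transpose U'"
  note pu = slice_svd_proj[OF svd, folded u_def] and pu' = slice_svd_proj[OF svd', folded u'_def]
  obtain y where y: "x ** y = u" "\<And>w. norm (y *v w) \<le> norm w / \<sigma>"
    using slice_svd_pinv[OF svd \<sigma>] unfolding u_def by metis
  have gap: "norm (((mat 1 - u') ** u) *v w) \<le> \<eta> * norm w" for w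
  proof -
    have "(mat 1 - u') ** u = (mat 1 - u') ** ((x - x') ** y)"
    proof -
      have "(mat 1 - u') ** x' = 0" by (simp add: matrix_mult_diff_left pu')
      then show ?thesis
        unfolding y(1)[symmetric] by (simp add: matrix_mult_diff_left[of x x'] matrix_mult_diff_right matrix_mul_assoc)
    qed
    then have "norm (((mat 1 - u') ** u) *v w) = norm ((mat 1 - u') *v ((x - x') *v (y *v w)))"
      by (simp add: matrix_vector_mul_assoc matrix_mul_assoc)
    also have "\<dots> \<le> norm ((x - x') *v (y *v w))"
      by (rule orth_proj_norm_le(1)[OF orth_proj_matrix(2)[OF pu'(1,2)]])
    also have "\<dots> \<le> norm (x - x') * norm (y *v w)" by (rule norm_matrix_vector_le)
    also have "\<dots> \<le> (\<eta> * \<sigma>) * (norm w / \<sigma>)"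
      using near y(2) \<sigma>(1) \<eta> by (intro mult_mono) auto
    finally show ?thesis using \<sigma>(1) by simp
  qed
  then show "norm (((mat 1 - U' ** transpose U') ** (U ** transpose U)) *v w) \<le> \<eta> * norm w"
    by (simp only: u_def u'_def)
  have "rank u = rank u'"
    using slice_svd_rank[OF svd] slice_svd_rank[OF svd'] rk by (simp add: u_def u'_def)
  then have "norm ((u - u') *v w) \<le> \<eta> * norm w"
    by (rule equal_rank_proj_diff[OF pu(1,2) pu'(1,2) _ gap \<eta>])
  then show "norm ((U ** transpose U - U' ** transpose U') *v w) \<le> \<eta> * norm w"
    by (simp only: u_def u'_def)
qed

text \<open>A DCT slice of the projection onto the normal space (see \<open>tdct_tangent_normal\<close>).\<close>

definition slice_normal ::
  "real ^ ('r::{finite,linorder}) ^ 'a \<Rightarrow> real ^ ('r::{finite,linorder}) ^ 'b \<Rightarrow> real ^ 'b ^ 'a \<Rightarrow> real ^ 'b ^ 'a" where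
  "slice_normal U V a = (mat 1 - U ** transpose U) ** a ** (mat 1 - V ** transpose V)"

text \<open>The normal projection is the product a \<mapsto> (1 - u) a (1 - v), so changing one
  factor at a time leaves two terms, each at most \<eta> norm a.\<close>

lemma slice_normal_diff_le:
  assumes svd: "slice_svd n x U S V" and svd': "slice_svd n' x' U' S' V'" and rk: "rank x = rank x'"
    and \<sigma>: "0 < \<sigma>" "\<And>i. index_pos i < n \<Longrightarrow> \<sigma> \<le> S $ i $ i"
    and near: "norm (x - x') \<le> \<eta> * \<sigma>" and \<eta>: "0 \<le> \<eta>" "\<eta> < 1"
  shows "norm (slice_normal U V a - slice_normal U' V' a) \<le> 2 * \<eta> * norm a"
proof -
  define u u' v v' where "u = U ** transpose U" and "u' = U' ** transpose U'"
    and "v = V ** transpose V" and "v' = V' ** transpose V'"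
  note svdT = slice_svd_transpose[OF svd] and svdT' = slice_svd_transpose[OF svd']
  note pu' = slice_svd_proj[OF svd', folded u'_def] and pv = slice_svd_proj[OF svdT, folded v_def]
    and pv' = slice_svd_proj[OF svdT', folded v'_def]
  have near': "norm (transpose x - transpose x') \<le> \<eta> * \<sigma>"
    using near by (metis norm_transpose transpose_diff)
  have du: "norm ((u - u') *v w) \<le> \<eta> * norm w" for w
    unfolding u_def u'_def by (rule slice_svd_gap[OF svd svd' rk \<sigma> near \<eta>])
  have dv: "norm ((v - v') *v w) \<le> \<eta> * norm w" for w
    unfolding v_def v'_def
    by (rule slice_svd_gap[OF svdT svdT' _ \<sigma> near' \<eta>]) (simp_all add: rank_transpose rk)
  have "slice_normal U V a - slice_normal U' V' a
      = (mat 1 - u') ** (a ** (v' - v)) - (u - u') ** (a ** (mat 1 - v))"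
    by (simp add: slice_normal_def u_def u'_def v_def v'_def matrix_mult_diff_left
        matrix_mult_diff_right matrix_mul_assoc)
  also have "norm \<dots> \<le> norm ((mat 1 - u') ** (a ** (v' - v))) + norm ((u - u') ** (a ** (mat 1 - v)))"
    by (rule norm_triangle_ineq4)
  also have "\<dots> \<le> 1 * norm (a ** (v' - v)) + \<eta> * norm (a ** (mat 1 - v))"
    by (intro add_mono norm_matrix_mult_le_left du)
      (simp add: orth_proj_norm_le(1)[OF orth_proj_matrix(2)[OF pu'(1,2)]])
  also have "\<dots> \<le> 1 * (\<eta> * norm a) + \<eta> * (1 * norm a)"
  proof (intro add_mono mult_left_mono norm_matrix_mult_le_right)
    fix w
    have "transpose (v' - v) *v w = - ((v - v') *v w)"
      by (simp add: transpose_diff pv(1) pv'(1) matrix_vector_mult_diff_rdistrib)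
    then show "norm (transpose (v' - v) *v w) \<le> \<eta> * norm w" using dv by simp
    show "norm (transpose (mat 1 - v) *v w) \<le> 1 * norm w"
      using orth_proj_norm_le(1)[OF orth_proj_matrix(2)[OF pv(1,2)]]
      by (simp add: transpose_diff pv(1))
  qed (use \<eta> in auto)
  finally show ?thesis by simp
qed

text \<open>The normal part at x' annihilates x', leaving (1 - u') x (1 - v'). Inserting x = u x and
  x' (1 - v') = 0 yields ((1 - u') u) ((x - x') (1 - v')): the gap supplies a factor \<eta> beside
  the distance itself.\<close>

lemma slice_normal_self_le:
  assumes svd: "slice_svd n x U S V" and svd': "slice_svd n' x' U' S' V'" and rk: "rank x = rank x'"
    and \<sigma>: "0 < \<sigma>" "\<And>i. index_pos i < n \<Longrightarrow> \<sigma> \<le> S $ i $ i"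
    and near: "norm (x - x') \<le> \<eta> * \<sigma>" and \<eta>: "0 \<le> \<eta>" "\<eta> < 1"
  shows "norm (slice_normal U' V' (x - x')) \<le> \<eta> * norm (x - x')"
proof -
  define u u' v' where "u = U ** transpose U" and "u' = U' ** transpose U'" and "v' = V' ** transpose V'"
  note svdT' = slice_svd_transpose[OF svd']
  note pu = slice_svd_proj[OF svd, folded u_def]
  note pu' = slice_svd_proj[OF svd', folded u'_def] and pv' = slice_svd_proj[OF svdT', folded v'_def]
  have x'v: "x' ** v' = x'"
    using arg_cong[OF pv'(3), of transpose] by (simp add: matrix_transpose_mul pv'(1) del: transpose_iff)
  have "slice_normal U' V' (x - x') = (mat 1 - u') ** x ** (mat 1 - v')"
    using pu'(3) by (simp add: slice_normal_def u'_def v'_def matrix_mult_diff_left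
        matrix_mult_diff_right matrix_mul_assoc)
  also have "\<dots> = (mat 1 - u') ** (u ** x) ** (mat 1 - v')" by (simp only: pu(3))
  also have "\<dots> = ((mat 1 - u') ** u) ** (x ** (mat 1 - v'))" by (simp only: matrix_mul_assoc)
  also have "x ** (mat 1 - v') = (x - x') ** (mat 1 - v')"
    using x'v by (simp add: matrix_mult_diff_left matrix_mult_diff_right)
  also have "norm (((mat 1 - u') ** u) ** \<dots>) \<le> \<eta> * norm ((x - x') ** (mat 1 - v'))"
    unfolding u_def u'_def
    by (intro norm_matrix_mult_le_left slice_svd_gap(1)[OF svd svd' rk \<sigma> near \<eta>])
  also have "\<dots> \<le> \<eta> * (1 * norm (x - x'))"
  proof (intro mult_left_mono norm_matrix_mult_le_right)
    show "norm (transpose (mat 1 - v') *v w) \<le> 1 * norm w" for w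
      using orth_proj_norm_le(1)[OF orth_proj_matrix(2)[OF pv'(1,2)]]
      by (simp add: transpose_diff pv'(1))
  qed (use \<eta> in auto)
  finally show ?thesis by simp
qed

section \<open>Best low-rank approximation by truncated singular value decompositions\<close>

lemma bessel_inequality:
  fixes x :: "'t::real_inner"
  assumes "finite I" and on: "\<And>i j. i \<in> I \<Longrightarrow> j \<in> I \<Longrightarrow> v i \<bullet> v j = (if i = j then 1 else 0)"
  shows "(\<Sum>i\<in>I. (x \<bullet> v i)\<^sup>2) \<le> (norm x)\<^sup>2"
proof -
  define y where "y = (\<Sum>i\<in>I. (x \<bullet> v i) *\<^sub>R v i)"
  have xy: "x \<bullet> y = (\<Sum>i\<in>I. (x \<bullet> v i)\<^sup>2)"
    by (simp add: y_def inner_sum_right power2_eq_square)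
  have vy: "v i \<bullet> y = x \<bullet> v i" if "i \<in> I" for i
  proof -
    have "v i \<bullet> y = (\<Sum>j\<in>I. if j = i then x \<bullet> v i else 0)"
      unfolding y_def inner_sum_right using on that by (intro sum.cong) auto
    then show ?thesis using assms(1) that by simp
  qed
  have "y \<bullet> y = (\<Sum>i\<in>I. (x \<bullet> v i) * (v i \<bullet> y))"
    by (subst (1) y_def) (simp add: inner_sum_left)
  also have "\<dots> = (\<Sum>i\<in>I. (x \<bullet> v i)\<^sup>2)"
    using vy by (intro sum.cong) (auto simp: power2_eq_square)
  finally have yy: "y \<bullet> y = (\<Sum>i\<in>I. (x \<bullet> v i)\<^sup>2)" .
  have "0 \<le> (x - y) \<bullet> (x - y)" by simp
  also have "\<dots> = x \<bullet> x - (\<Sum>i\<in>I. (x \<bullet> v i)\<^sup>2)"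
    using xy yy by (simp add: inner_diff_left inner_diff_right inner_commute)
  finally show ?thesis by (simp add: power2_norm_eq_inner)
qed

lemma inner_outer_prod: "outer_prod a b \<bullet> outer_prod c d = (a \<bullet> c) * (b \<bullet> d)"
proof -
  have "outer_prod a b \<bullet> outer_prod c d
      = (\<Sum>i\<in>UNIV. \<Sum>j\<in>UNIV. (a $ i * c $ i) * (b $ j * d $ j))"
    by (simp add: outer_prod_def inner_vec_def mult_ac)
  then show ?thesis by (simp add: inner_vec_def sum_product)
qed

text \<open>Orthonormality is asked of the left factors alone: after multiplication by
  \<open>mat 1 - q\<close> the right factors of an SVD are no longer orthonormal.\<close>

lemma norm_sum_outer_prod:
  assumes "finite I" and on: "\<And>i j. i \<in> I \<Longrightarrow> j \<in> I \<Longrightarrow> u i \<bullet> u j = (if i = j then 1 else 0)"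
  shows "(norm (\<Sum>i\<in>I. s i *\<^sub>R outer_prod (u i) (w i)))\<^sup>2 = (\<Sum>i\<in>I. (s i)\<^sup>2 * (norm (w i))\<^sup>2)"
proof -
  have "(norm (\<Sum>i\<in>I. s i *\<^sub>R outer_prod (u i) (w i)))\<^sup>2
      = (\<Sum>i\<in>I. \<Sum>j\<in>I. s i * s j * ((u i \<bullet> u j) * (w i \<bullet> w j)))"
    unfolding power2_norm_eq_inner inner_sum_left
    unfolding inner_sum_right by (simp add: inner_outer_prod mult_ac)
  also have "\<dots> = (\<Sum>i\<in>I. \<Sum>j\<in>I. if j = i then (s i)\<^sup>2 * (norm (w i))\<^sup>2 else 0)"
    using on by (intro sum.cong) (auto simp: power2_eq_square[of "s _"] power2_norm_eq_inner)
  finally show ?thesis using assms(1) by simp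
qed

lemma outer_prod_matrix_mult: "outer_prod a b ** M = outer_prod a (transpose M *v b)"
  by (simp add: outer_prod_def matrix_matrix_mult_def matrix_vector_mult_def transpose_def
      vec_eq_iff sum_distrib_left mult_ac del: transpose_matrix_vector)

lemma sum_scaleR_matrix_mult:
  "(\<Sum>i\<in>I. s i *\<^sub>R f i) ** M = (\<Sum>i\<in>I. s i *\<^sub>R (f i ** M))" for M :: "real ^ 'b ^ 'd"
proof -
  have "linear (\<lambda>A. A ** M)"
    by (rule linearI) (simp_all add: matrix_mult_add_left matrix_matrix_mult_def vec_eq_iff
        sum_distrib_left distrib_left sum.distrib mult_ac)
  then interpret linear "\<lambda>A. A ** M" .
  show ?thesis by (simp add: sum scale)
qed

text \<open>Bessel's inequality for each row of \<open>q\<close>; the squared row norms add up to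
  the trace of \<open>q ** transpose q\<close>, which is that of \<open>q\<close>.\<close>

lemma sum_proj_weights_le:
  fixes q :: "real ^ 'b ^ 'b"
  assumes q: "transpose q = q" "q ** q = q"
    and "finite I" and on: "\<And>i j. i \<in> I \<Longrightarrow> j \<in> I \<Longrightarrow> v i \<bullet> v j = (if i = j then 1 else 0)"
  shows "(\<Sum>i\<in>I. (norm (q *v v i))\<^sup>2) \<le> trace q"
proof -
  have "(\<Sum>i\<in>I. (norm (q *v v i))\<^sup>2) = (\<Sum>i\<in>I. \<Sum>j\<in>UNIV. (q $ j \<bullet> v i)\<^sup>2)"
    unfolding power2_norm_eq_inner inner_vec_def[of "q *v _"] matrix_vector_mul_component
    by (simp add: power2_eq_square)
  also have "\<dots> = (\<Sum>j\<in>UNIV. \<Sum>i\<in>I. (q $ j \<bullet> v i)\<^sup>2)" by (rule sum.swap)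
  also have "\<dots> \<le> (\<Sum>j\<in>UNIV. (norm (q $ j))\<^sup>2)"
    by (intro sum_mono bessel_inequality assms)
  also have "\<dots> = trace (q ** transpose q)"
    by (simp add: trace_def matrix_matrix_mult_def transpose_def power2_norm_eq_inner inner_vec_def)
  finally show ?thesis by (simp only: q)
qed

text \<open>The Eckart--Young theorem.  The competitor \<open>B\<close> of rank at most \<open>k\<close> enters through a
  projection \<open>q\<close> that contains its row space.\<close>

lemma svd_truncation_optimal:
  fixes W B :: "real ^ 'b ^ 'a"
  assumes tr: "is_svd_truncation k W Z"
    and q: "transpose q = q" "q ** q = q" "trace q \<le> real k" and B: "B ** q = B"
  shows "norm (W - Z) \<le> norm (W - B)"
proof -
  obtain d u s v where svd: "is_svd W d u s v"
    and Z: "Z = (\<Sum>i<min k d. s i *\<^sub>R outer_prod (u i) (v i))"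
    using tr unfolding is_svd_truncation_def by blast
  have u: "\<And>i j. i < d \<Longrightarrow> j < d \<Longrightarrow> u i \<bullet> u j = (if i = j then 1 else 0)"
    and v: "\<And>i j. i < d \<Longrightarrow> j < d \<Longrightarrow> v i \<bullet> v j = (if i = j then 1 else 0)"
    and s0: "\<And>i. i < d \<Longrightarrow> 0 \<le> s i" and smono: "\<And>i j. i \<le> j \<Longrightarrow> j < d \<Longrightarrow> s j \<le> s i"
    and W: "W = (\<Sum>i<d. s i *\<^sub>R outer_prod (u i) (v i))"
    using svd unfolding is_svd_def by auto
  have v1: "norm (v i) = 1" if "i < d" for i
    using v[OF that that] by (simp add: norm_eq_1)
  define t where "t i = (norm (q *v v i))\<^sup>2" for i
  have oq: "orth_proj ((*v) q)" "orth_proj ((*v) (mat 1 - q))" using orth_proj_matrix q by auto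
  have t1: "t i \<le> 1" if "i < d" for i
    using orth_proj_norm_le(1)[OF oq(1), of "v i"] v1[OF that] by (simp add: t_def power_le_one)
  have t0: "0 \<le> t i" for i by (simp add: t_def)
  have tsum: "(\<Sum>i<d. t i) \<le> real k"
    using sum_proj_weights_le[OF q(1,2), of "{..<d}" v] v q(3) by (simp add: t_def)
  have tq: "transpose (mat 1 - q) = mat 1 - q" by (simp add: transpose_diff q)
  have "(\<Sum>i<d. f i) = (\<Sum>i<min k d. f i) + (\<Sum>i\<in>{min k d..<d}. f i)"
    for f :: "nat \<Rightarrow> real ^ 'b ^ 'a"
    by (subst sum.union_disjoint[symmetric]) (auto intro!: sum.cong)
  then have "W - Z = (\<Sum>i\<in>{min k d..<d}. s i *\<^sub>R outer_prod (u i) (v i))"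
    unfolding W Z by simp
  then have "(norm (W - Z))\<^sup>2 = (\<Sum>i\<in>{min k d..<d}. (s i)\<^sup>2 * (norm (v i))\<^sup>2)"
    by (simp only:) (rule norm_sum_outer_prod, use u in auto)
  also have "\<dots> = (\<Sum>i\<in>{min k d..<d}. (s i)\<^sup>2)" using v1 by (intro sum.cong) auto
  also have "\<dots> \<le> (\<Sum>i<d. (s i)\<^sup>2 * (1 - t i))"
  proof (cases "d \<le> k")
    case True
    then show ?thesis using t1 by (auto intro!: sum_nonneg)
  next
    case False
    have split: "{..<d} = {..<k} \<union> {k..<d}" using False by auto
    \<comment> \<open>The threshold at the cut: squared singular values before position
      \<open>k\<close> are at least \<open>c\<close>, later ones at most \<open>c\<close>. The
      weights \<open>t i\<close> lie in [0, 1] and sum to at most \<open>k\<close>, so they capture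
      at most the first \<open>k\<close> squares.\<close>
    define c where "c = (s k)\<^sup>2"
    have "0 \<le> c * (real k - (\<Sum>i<d. t i))" using tsum by (simp add: c_def)
    also have "\<dots> = (\<Sum>i<k. c * (1 - t i)) - (\<Sum>i\<in>{k..<d}. c * t i)"
      unfolding split
      by (simp add: sum.union_disjoint disjoint_iff sum_distrib_left[symmetric] sum_subtractf algebra_simps)
    also have "\<dots> \<le> (\<Sum>i<k. (s i)\<^sup>2 * (1 - t i)) - (\<Sum>i\<in>{k..<d}. (s i)\<^sup>2 * t i)"
      using False t0 t1 s0 smono unfolding c_def
      by (intro diff_mono sum_mono mult_right_mono power_mono) auto
    also have "\<dots> = (\<Sum>i<d. (s i)\<^sup>2 * (1 - t i)) - (\<Sum>i\<in>{k..<d}. (s i)\<^sup>2)"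
      unfolding split by (simp add: sum.union_disjoint disjoint_iff sum_subtractf algebra_simps)
    finally show ?thesis using False by (simp add: min_def)
  qed
  also have "\<dots> = (\<Sum>i<d. (s i)\<^sup>2 * (norm ((mat 1 - q) *v v i))\<^sup>2)"
  proof (intro sum.cong refl)
    fix i assume "i \<in> {..<d}"
    then have "1 - t i = (norm ((mat 1 - q) *v v i))\<^sup>2"
      using orth_proj_pythagoras[OF oq(1), of "v i"] v1
      by (simp add: t_def matrix_vector_mult_diff_rdistrib)
    then show "(s i)\<^sup>2 * (1 - t i) = (s i)\<^sup>2 * (norm ((mat 1 - q) *v v i))\<^sup>2" by simp
  qed
  also have "\<dots> = (norm (W ** (mat 1 - q)))\<^sup>2"
    unfolding W sum_scaleR_matrix_mult outer_prod_matrix_mult tq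
    by (rule norm_sum_outer_prod[symmetric]) (use u in auto)
  \<comment> \<open>The competitor disappears here, because B (1 - q) = 0.\<close>
  also have "W ** (mat 1 - q) = (W - B) ** (mat 1 - q)"
    using B by (simp add: matrix_mult_diff_left matrix_mult_diff_right)
  finally have "norm (W - Z) \<le> norm ((W - B) ** (mat 1 - q))"
    by (rule power2_le_imp_le) simp
  also have "\<dots> \<le> 1 * norm (W - B)"
    using orth_proj_norm_le(1)[OF oq(2)] by (intro norm_matrix_mult_le_right) (simp only: tq mult_1)
  finally show ?thesis by simp
qed

section \<open>Singular values of the block diagonal matrix\<close>

lemma finite_eigenvalues_symmetric:
  fixes A :: "real ^ 'n ^ 'n"
  assumes A: "transpose A = A"
  shows "finite {c. \<exists>v. v \<noteq> 0 \<and> A *v v = c *\<^sub>R v}" (is "finite ?L")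
proof -
  have "\<forall>c\<in>?L. \<exists>v. v \<noteq> 0 \<and> A *v v = c *\<^sub>R v" by blast
  from bchoice[OF this]
  obtain e where e: "\<And>c. c \<in> ?L \<Longrightarrow> e c \<noteq> 0 \<and> A *v e c = c *\<^sub>R e c" by blast
  have orth: "e c \<bullet> e d = 0" if "c \<in> ?L" "d \<in> ?L" "c \<noteq> d" for c d
  proof -
    have "c * (e c \<bullet> e d) = (A *v e c) \<bullet> e d" using e[OF that(1)] by simp
    also have "\<dots> = e c \<bullet> (A *v e d)" using inner_matrix_vector[of A "e c" "e d"] A by simp
    also have "\<dots> = d * (e c \<bullet> e d)" using e[OF that(2)] by simp
    finally show ?thesis using that(3) by simp
  qed
  \<comment> \<open>Nonzero eigenvectors for distinct eigenvalues are orthogonal, hence independent,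
    and the dimension bounds their number.\<close>
  have "independent (e ` ?L)"
    using orth e by (intro pairwise_orthogonal_independent) (fastforce simp: pairwise_def orthogonal_def)+
  then have "finite (e ` ?L)" using independent_bound by blast
  moreover have "inj_on e ?L"
  proof (rule inj_onI, rule ccontr)
    fix c d assume "c \<in> ?L" "d \<in> ?L" "e c = e d" "c \<noteq> d"
    then show False using orth[of c d] e[of d] by simp
  qed
  ultimately show ?thesis using finite_imageD by blast
qed

text \<open>Squaring is injective on nonnegative reals and maps singular values to eigenvalues of a
  symmetric matrix. Finiteness makes the \<open>Min\<close> in \<open>sigma_min\<close> a genuine
  minimum.\<close>

lemma finite_singular_values: "finite (singular_values M)"
proof (rule finite_imageD)
  have "transpose (transpose M ** M) = transpose M ** M" by (simp add: matrix_transpose_mul)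
  from finite_eigenvalues_symmetric[OF this] show "finite ((\<lambda>s. s\<^sup>2) ` singular_values M)"
    by (rule finite_subset[rotated]) (auto simp: singular_values_def)
  show "inj_on (\<lambda>s. s\<^sup>2) (singular_values M)"
    by (auto intro!: inj_onI simp: singular_values_def)
qed

definition embed_block :: "'c::finite \<Rightarrow> real ^ ('b::finite) \<Rightarrow> real ^ ('b \<times> 'c)" where
  "embed_block k x = (\<chi> q. if snd q = k then x $ fst q else 0)"

lemma sum_restrict_snd:
  fixes f :: "'e::finite \<Rightarrow> real" and k :: "'c::finite"
  shows "(\<Sum>q\<in>UNIV. if snd q = k then f (fst q) else 0) = (\<Sum>j\<in>UNIV. f j)"
proof -
  have "(\<Sum>q\<in>UNIV. if snd q = k then f (fst q) else 0)
      = (\<Sum>(j, l)\<in>UNIV \<times> UNIV. if l = k then f j else 0)"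
    by (rule sum.cong) auto
  also have "\<dots> = (\<Sum>j\<in>UNIV. \<Sum>l\<in>UNIV. if l = k then f j else 0)"
    by (rule sum.cartesian_product[symmetric])
  finally show ?thesis by simp
qed

lemma block_diag_embed:
  fixes X :: "('a::finite, 'b::finite, 'c::{finite,linorder}) tensor"
  shows "block_diag X *v embed_block k x = embed_block k (tdct X $ k *v x)"
    and "transpose (block_diag X) *v embed_block k y = embed_block k (transpose (tdct X $ k) *v y)"
proof -
  show "block_diag X *v embed_block k x = embed_block k (tdct X $ k *v x)"
  proof (rule vec_eq_iff[THEN iffD2], rule allI)
    fix p :: "'a \<times> 'c"
    have "(block_diag X *v embed_block k x) $ p
        = (\<Sum>q\<in>UNIV. if snd q = k then (if snd p = k then tdct X $ k $ fst p $ fst q * x $ fst q else 0) else 0)"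
      unfolding matrix_vector_mult_def block_diag_def embed_block_def vec_lambda_beta
      by (rule sum.cong) auto
    also have "\<dots> = (embed_block k (tdct X $ k *v x)) $ p"
      unfolding sum_restrict_snd[of k "\<lambda>j. if snd p = k then tdct X $ k $ fst p $ j * x $ j else 0"]
      by (simp add: embed_block_def matrix_vector_mult_def)
    finally show "(block_diag X *v embed_block k x) $ p = (embed_block k (tdct X $ k *v x)) $ p" .
  qed
  show "transpose (block_diag X) *v embed_block k y = embed_block k (transpose (tdct X $ k) *v y)"
  proof (rule vec_eq_iff[THEN iffD2], rule allI)
    fix p :: "'b \<times> 'c"
    have "(transpose (block_diag X) *v embed_block k y) $ p
        = (\<Sum>q\<in>UNIV. if snd q = k then (if snd p = k then tdct X $ k $ fst q $ fst p * y $ fst q else 0) else 0)"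
      unfolding matrix_vector_mult_def block_diag_def embed_block_def vec_lambda_beta transpose_def
      by (rule sum.cong) auto
    also have "\<dots> = (embed_block k (transpose (tdct X $ k) *v y)) $ p"
      unfolding sum_restrict_snd[of k "\<lambda>j. if snd p = k then tdct X $ k $ j $ fst p * y $ j else 0"]
      by (simp add: embed_block_def matrix_vector_mult_def transpose_def del: transpose_matrix_vector)
    finally show "(transpose (block_diag X) *v embed_block k y) $ p
        = (embed_block k (transpose (tdct X $ k) *v y)) $ p" .
  qed
qed

text \<open>Column \<open>i\<close> of \<open>V\<close> is a right singular vector of the slice;
  placed in block \<open>k\<close> and padded with zeros it becomes one of the whole block diagonal
  matrix.\<close>

lemma slice_singular_value:
  fixes X :: "('a::finite, 'b::finite, 'c::{finite,linorder}) tensor"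
    and U :: "real ^ ('r::{finite,linorder}) ^ 'a" and V :: "real ^ ('r::{finite,linorder}) ^ 'b"
  assumes svd: "slice_svd n (tdct X $ k) U S V" and i: "index_pos i < n"
  shows "S $ i $ i \<in> singular_values (block_diag X) - {0}"
proof -
  have U: "transpose U ** U = coord_mat n" and V: "transpose V ** V = coord_mat n"
    and x: "tdct X $ k = U ** S ** transpose V"
    using svd unfolding slice_svd_def by blast+
  obtain s where s: "S = diag_mat s" "\<And>i. if index_pos i < n then 0 < s i else s i = 0"
    using svd unfolding slice_svd_def by blast
  define a :: "real ^ ('r::{finite,linorder})" where "a = axis i 1"
  have Sii: "S $ i $ i = s i" by (simp add: s(1) diag_mat_def)
  have pos: "0 < s i" using s(2)[of i] i by simp
  have da: "diag_mat f *v a = f i *\<^sub>R a" for f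
    by (simp add: vec_eq_iff diag_mat_vector a_def axis_def)
  have Sa: "S *v a = s i *\<^sub>R a" unfolding s(1) by (rule da)
  have Da: "coord_mat n *v a = a" using i by (simp add: coord_mat_def da)
  define c where "c = V *v a"
  have "tdct X $ k *v c = U *v (S *v ((transpose V ** V) *v a))"
    by (simp only: x c_def matrix_vector_mul_assoc matrix_mul_assoc)
  then have 1: "tdct X $ k *v c = s i *\<^sub>R (U *v a)"
    by (simp add: V Da Sa matrix_vector_mult_scaleR)
  have "transpose (tdct X $ k) *v (U *v a) = V *v (transpose S *v ((transpose U ** U) *v a))"
    by (simp only: x matrix_vector_mul_assoc matrix_mul_assoc matrix_transpose_mul transpose_transpose)
  then have 2: "transpose (tdct X $ k) *v (U *v a) = s i *\<^sub>R c"
    by (simp only: U Da transpose_diag_mat s(1) da matrix_vector_mult_scaleR c_def)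
  have embed_scale: "embed_block k (t *\<^sub>R y) = t *\<^sub>R embed_block k y" for t and y :: "real ^ 'b"
    by (simp add: embed_block_def vec_eq_iff)
  have "(transpose (block_diag X) ** block_diag X) *v embed_block k c
      = transpose (block_diag X) *v (block_diag X *v embed_block k c)"
    by (rule matrix_vector_mul_assoc[symmetric])
  also have "\<dots> = embed_block k (transpose (tdct X $ k) *v (s i *\<^sub>R (U *v a)))"
    by (simp only: block_diag_embed 1)
  also have "\<dots> = (s i)\<^sup>2 *\<^sub>R embed_block k c"
    by (simp only: matrix_vector_mult_scaleR 2 embed_scale scaleR_scaleR power2_eq_square)
  finally have eig: "(transpose (block_diag X) ** block_diag X) *v embed_block k c = (s i)\<^sup>2 *\<^sub>R embed_block k c" .
  \<comment> \<open>\<open>V\<close> preserves the length of a coordinate vector below position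
    \<open>n\<close>, so the eigenvector is nonzero.\<close>
  have "c \<bullet> c = a \<bullet> (transpose V *v (V *v a))" unfolding c_def by (rule inner_matrix_vector)
  also have "transpose V *v (V *v a) = a" by (simp only: matrix_vector_mul_assoc V Da)
  finally have "c \<noteq> 0" by (auto simp: a_def inner_axis_axis)
  then obtain j where "c $ j \<noteq> 0" by (auto simp: vec_eq_iff)
  then have "embed_block k c $ (j, k) \<noteq> 0" by (simp add: embed_block_def)
  then have "embed_block k c \<noteq> 0" by auto
  with eig pos show ?thesis unfolding singular_values_def Sii by auto
qed

lemma skinny_tcsvd_slice:
  assumes "skinny_tcsvd r X U S V"
  shows "slice_svd (r k) (tdct X $ k) (tdct U $ k) (tdct S $ k) (tdct V $ k)"
proof -
  have X: "X = U **\<^sub>t S **\<^sub>t ttranspose V" and U: "ttranspose U **\<^sub>t U = trunc_id r"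
    and V: "ttranspose V **\<^sub>t V = trunc_id r"
    and S: "\<And>i j. i \<noteq> j \<Longrightarrow> tdct S $ k $ i $ j = 0"
    "\<And>i. if index_pos i < r k then 0 < tdct S $ k $ i $ i else tdct S $ k $ i $ i = 0"
    using assms unfolding skinny_tcsvd_def by blast+
  have I: "tdct (trunc_id r) $ k = coord_mat (r k)"
    unfolding tdct_trunc_id coord_mat_def diag_mat_def vec_eq_iff by simp
  have "tdct X $ k = tdct U $ k ** tdct S $ k ** transpose (tdct V $ k)"
    by (subst X) (simp add: tdct_tprod tdct_ttranspose)
  moreover have "transpose (tdct U $ k) ** tdct U $ k = coord_mat (r k)"
    "transpose (tdct V $ k) ** tdct V $ k = coord_mat (r k)"
    using arg_cong[OF U, of "\<lambda>t. tdct t $ k"] arg_cong[OF V, of "\<lambda>t. tdct t $ k"]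
    by (simp_all add: tdct_tprod tdct_ttranspose I)
  moreover have "tdct S $ k = diag_mat (\<lambda>i. tdct S $ k $ i $ i)"
    using S(1) by (simp add: vec_eq_iff diag_mat_def)
  ultimately show ?thesis using S(2) unfolding slice_svd_def by blast
qed

lemma sigma_min_bound:
  fixes X :: "('a::finite, 'b::finite, 'c::{finite,linorder}) tensor"
    and U :: "('a, 'r::{finite,linorder}, 'c) tensor"
  assumes svd: "skinny_tcsvd r X U S V"
  shows "0 < sigma_min X" and "index_pos i < r k \<Longrightarrow> sigma_min X \<le> tdct S $ k $ i $ i"
proof -
  let ?A = "singular_values (block_diag X) - {0}"
  have fin: "finite ?A" using finite_singular_values by blast
  note mem = slice_singular_value[OF skinny_tcsvd_slice[OF svd]]
  show "index_pos i < r k \<Longrightarrow> sigma_min X \<le> tdct S $ k $ i $ i"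
    unfolding sigma_min_def by (rule Min_le[OF fin mem])
  \<comment> \<open>Some slice has rank equal to the cardinality of the nonempty type
    \<open>'r\<close>. Hence a nonzero singular value exists and the minimum is attained and
    positive.\<close>
  have "Max (range r) \<in> range r" by (rule Max_in) auto
  moreover have "CARD('r) = Max (range r)" using svd unfolding skinny_tcsvd_def by blast
  ultimately obtain l where "r l = CARD('r)" by (metis rangeE)
  moreover obtain i0 :: 'r where "index_pos i0 = 0"
    using index_pos_bij[where 'i = 'r] unfolding bij_betw_def
    by (metis imageE lessThan_iff zero_less_card_finite)
  ultimately have "index_pos i0 < r l" by simp
  from mem[OF this] have "?A \<noteq> {}" by blast
  with fin have "sigma_min X \<in> ?A" unfolding sigma_min_def by (rule Min_in)
  then show "0 < sigma_min X" unfolding singular_values_def by auto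
qed

subsection \<open>Tensors\<close>

lemma norm_tdct: "norm (tdct A) = norm A"
  by (simp add: norm_eq_sqrt_inner tdct_inner)

text \<open>Orthogonality of A - P A to the tangent space gives <A, P B> = <P A, P B>, which is
  symmetric; applied to P A it gives idempotence.\<close>

lemma orth_proj_tangent_proj:
  assumes svd: "skinny_tcsvd r X U S V"
  shows "orth_proj (tangent_proj U V)"
proof -
  let ?P = "tangent_proj U V"
  have U: "ttranspose U **\<^sub>t U = trunc_id r" and V: "ttranspose V **\<^sub>t V = trunc_id r"
    using svd unfolding skinny_tcsvd_def by blast+
  have orth: "(A - ?P A) \<bullet> ?P B = 0" for A B
    by (rule tangent_proj_orthogonal(2)[OF U V tangent_proj_orthogonal(1)[OF U V]])
  have "?P A \<bullet> B = A \<bullet> ?P B" for A B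
  proof -
    have "A \<bullet> ?P B = ?P A \<bullet> ?P B" "B \<bullet> ?P A = ?P B \<bullet> ?P A"
      using orth[of A B] orth[of B A] by (simp_all add: inner_diff_left)
    then show ?thesis by (simp add: inner_commute)
  qed
  moreover have "?P (?P A) = ?P A" for A
  proof -
    have "(?P A - ?P (?P A)) \<bullet> (?P A - ?P (?P A)) = 0"
      using orth[of "?P A"] by (simp add: inner_diff_right)
    then show ?thesis by simp
  qed
  ultimately show ?thesis unfolding orth_proj_def selfadjoint_def by blast
qed

text \<open>The three terms of \<open>tangent_proj\<close> complete to a product: a - u a - a v + u
  a v = (1 - u) a (1 - v), where u and v are the slice projections.\<close>

lemma tdct_tangent_normal:
  "tdct (A - tangent_proj U V A) $ k = slice_normal (tdct U $ k) (tdct V $ k) (tdct A $ k)"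
  by (simp add: slice_normal_def tangent_proj_def tdct_tprod tdct_ttranspose tdct_add tdct_diff
      matrix_mult_diff_left matrix_mult_diff_right matrix_mul_assoc)

text \<open>The DCT preserves the norm, so the slice estimates add up. One \<eta> serves every
  slice: \<open>sigma_min X\<close> bounds all nonzero singular values from below, and each slice of
  X - X' is no larger than the whole tensor.\<close>

lemma tangent_proj_perturbation:
  fixes X X' :: "('a::finite, 'b::finite, 'c::{finite,linorder}) tensor"
    and U U' :: "('a, 'r::{finite,linorder}, 'c) tensor"
  assumes svd: "skinny_tcsvd r X U S V" and svd': "skinny_tcsvd r X' U' S' V'"
    and \<eta>: "norm (X' - X) / sigma_min X < 1"
  shows "norm (tangent_proj U' V' A - tangent_proj U V A)
      \<le> 2 * (norm (X' - X) / sigma_min X) * norm A"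
    and "norm ((X - X') - tangent_proj U' V' (X - X'))
      \<le> norm (X' - X) / sigma_min X * norm (X - X')"
proof -
  define \<eta> where "\<eta> = norm (X' - X) / sigma_min X"
  note \<sigma> = sigma_min_bound[OF svd]
  note slice = skinny_tcsvd_slice[OF svd] and slice' = skinny_tcsvd_slice[OF svd']
  have \<eta>01: "0 \<le> \<eta>" "\<eta> < 1" using \<eta> \<sigma>(1) by (simp_all add: \<eta>_def)
  have rk: "rank (tdct X $ k) = rank (tdct X' $ k)" for k
  proof -
    have "trank X = r" "trank X' = r" using svd svd' unfolding skinny_tcsvd_def by blast+
    then show ?thesis unfolding trank_def by metis
  qed
  have near: "norm (tdct X $ k - tdct X' $ k) \<le> \<eta> * sigma_min X" for k
  proof -
    have "norm (tdct (X - X') $ k) \<le> norm (X - X')"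
      unfolding norm_tdct[of "X - X'", symmetric] by (rule Finite_Cartesian_Product.norm_nth_le)
    then show ?thesis using \<sigma>(1) by (simp add: tdct_diff \<eta>_def norm_minus_commute)
  qed
  have "norm (tdct ((A - tangent_proj U V A) - (A - tangent_proj U' V' A))) \<le> 2 * \<eta> * norm (tdct A)"
  proof (rule norm_vec_le)
    fix k
    show "norm (tdct ((A - tangent_proj U V A) - (A - tangent_proj U' V' A)) $ k)
        \<le> 2 * \<eta> * norm (tdct A $ k)"
      unfolding tdct_diff[of "A - tangent_proj U V A"] vector_minus_component tdct_tangent_normal
      by (rule slice_normal_diff_le[OF slice slice' rk \<sigma> near \<eta>01])
  qed (use \<eta>01 in simp)
  then show "norm (tangent_proj U' V' A - tangent_proj U V A)
      \<le> 2 * (norm (X' - X) / sigma_min X) * norm A"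
    by (simp add: norm_tdct \<eta>_def)
  have "norm (tdct ((X - X') - tangent_proj U' V' (X - X'))) \<le> \<eta> * norm (tdct (X - X'))"
  proof (rule norm_vec_le)
    fix k
    show "norm (tdct ((X - X') - tangent_proj U' V' (X - X')) $ k) \<le> \<eta> * norm (tdct (X - X') $ k)"
      unfolding tdct_tangent_normal unfolding tdct_diff vector_minus_component
      by (rule slice_normal_self_le[OF slice slice' rk \<sigma> near \<eta>01])
  qed (use \<eta>01 in simp)
  then show "norm ((X - X') - tangent_proj U' V' (X - X'))
      \<le> norm (X' - X) / sigma_min X * norm (X - X')"
    by (simp add: norm_tdct \<eta>_def)
qed

text \<open>In each slice X is a competitor of admissible rank, its row space being contained in a
  projection of trace at most \<open>r k\<close>. So W is at least as close to Z as to X, and the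
  triangle inequality doubles the error.\<close>

lemma tcsvd_truncation_error:
  fixes X W Z :: "('a::finite, 'b::finite, 'c::{finite,linorder}) tensor"
  assumes svd: "skinny_tcsvd r X U S V" and tr: "is_tcsvd_truncation r W Z"
  shows "norm (Z - X) \<le> 2 * norm (W - X)"
proof -
  have "norm (tdct (W - Z)) \<le> 1 * norm (tdct (W - X))"
  proof (rule norm_vec_le)
    fix k
    note slice = slice_svd_transpose[OF skinny_tcsvd_slice[OF svd, of k]]
    note q = slice_svd_proj[OF slice]
    have "tdct X $ k ** (tdct V $ k ** transpose (tdct V $ k)) = tdct X $ k"
      using arg_cong[OF q(3), of transpose]
      unfolding matrix_transpose_mul[of _ "transpose (tdct X $ k)"] q(1) transpose_transpose .
    then have "norm (tdct W $ k - tdct Z $ k) \<le> norm (tdct W $ k - tdct X $ k)"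
      using tr unfolding is_tcsvd_truncation_def
      by (intro svd_truncation_optimal[OF _ q(1,2,4)]) auto
    then show "norm (tdct (W - Z) $ k) \<le> 1 * norm (tdct (W - X) $ k)"
      by (simp add: tdct_diff)
  qed simp
  then have "norm (W - Z) \<le> norm (W - X)" by (simp add: norm_tdct)
  moreover have "norm (Z - X) \<le> norm (W - X) + norm (W - Z)"
    using norm_triangle_ineq4[of "W - X" "W - Z"] by simp
  ultimately show ?thesis by simp
qed

section \<open>The sampling operator\<close>

lemma sampling_op_inner:
  "sampling_op \<Omega> x \<bullet> y = (\<Sum>e\<leftarrow>\<Omega>. (unit_tensor e \<bullet> x) * (unit_tensor e \<bullet> y))"
  unfolding sampling_op_def by (induction \<Omega>) (simp_all add: inner_add_left)

lemma selfadjoint_sampling_op: "selfadjoint (sampling_op \<Omega>)"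
  unfolding selfadjoint_def by (metis (no_types, lifting) sampling_op_inner inner_commute mult.commute map_eq_conv)

lemma sampling_op_psd: "0 \<le> x \<bullet> sampling_op \<Omega> x"
  unfolding inner_commute[of x] sampling_op_inner by (rule sum_list_nonneg) auto

text \<open>The Rayleigh quotient of the all-ones tensor equals the sampling density. This supplies
  p \<le> \<rho> for \<open>rip_transfer\<close>.\<close>

lemma sampling_density_le_onorm:
  fixes \<Omega> :: "('a::finite \<times> 'b::finite \<times> 'c::finite) list"
  shows "real (length \<Omega>) / real (CARD('a) * CARD('b) * CARD('c))
    \<le> onorm (sampling_op \<Omega> :: ('a, 'b, 'c) tensor \<Rightarrow> ('a, 'b, 'c) tensor)"
proof -
  let ?R = "sampling_op \<Omega> :: ('a, 'b, 'c) tensor \<Rightarrow> ('a, 'b, 'c) tensor"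
  define J :: "('a, 'b, 'c) tensor" where "J = 1"
  have unit: "unit_tensor e \<bullet> J = 1" for e
    by (cases e) (simp add: unit_tensor_def J_def inner_axis')
  have N: "(norm J)\<^sup>2 = real (CARD('a) * CARD('b) * CARD('c))"
    by (simp add: power2_norm_eq_inner J_def inner_vec_def)
  have "bounded_linear ?R"
    using selfadjoint_linear[OF selfadjoint_sampling_op] linear_conv_bounded_linear by blast
  then have "norm (?R J) \<le> onorm ?R * norm J" by (rule onorm)
  then have "norm (?R J) * norm J \<le> onorm ?R * norm J * norm J" by (simp add: mult_right_mono)
  moreover have "real (length \<Omega>) = ?R J \<bullet> J"
    by (simp add: sampling_op_inner unit sum_list_triv)
  moreover have "?R J \<bullet> J \<le> norm (?R J) * norm J" by (rule norm_cauchy_schwarz)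
  ultimately have "real (length \<Omega>) \<le> onorm ?R * (norm J)\<^sup>2" by (simp add: power2_eq_square mult_ac)
  then show ?thesis unfolding N by (simp add: pos_divide_le_eq)
qed

subsection \<open>The conjugate gradient step and its recursion\<close>

text \<open>The first restart condition bounds <g, q>, the near-isometry compares it with <g, R q>,
  and the second condition trades norm g for norm q. The second conclusion is the R-conjugacy of g +
  b q and q, multiplied by \<open>b\<close> so that it also covers b = 0; the third prevents
  cancellation in the search direction.\<close>

lemma cg_coeff_bound:
  fixes R :: "'t::real_inner \<Rightarrow> 't"
  assumes R: "linear R"
    and gq: "\<bar>g \<bullet> R q - p * (g \<bullet> q)\<bar> \<le> 4 * \<epsilon> * p * (norm g * norm q)"
    and qq: "(1 - 4 * \<epsilon>) * p * (norm q)\<^sup>2 \<le> q \<bullet> R q"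
    and p: "0 < p" and \<epsilon>: "0 < \<epsilon>" "1 - 4 * \<epsilon> > 0" and k: "0 \<le> k1" "0 \<le> k2"
    and b: "b = 0 \<or> b = cg_coeff k1 k2 R g q"
  shows "\<bar>b\<bar> \<le> k2 * (k1 + 4 * \<epsilon>) / (1 - 4 * \<epsilon>)"
    and "b * (g \<bullet> R q + b * (q \<bullet> R q)) = 0"
    and "(1 - k1\<^sup>2) * (norm g)\<^sup>2 \<le> (norm (g + b *\<^sub>R q))\<^sup>2"
proof -
  have "\<bar>b\<bar> \<le> k2 * (k1 + 4 * \<epsilon>) / (1 - 4 * \<epsilon>) \<and> b * (g \<bullet> R q + b * (q \<bullet> R q)) = 0
      \<and> (1 - k1\<^sup>2) * (norm g)\<^sup>2 \<le> (norm (g + b *\<^sub>R q))\<^sup>2"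
  proof (cases "b = 0")
    case True
    then show ?thesis using \<epsilon> k by (simp add: mult_left_le_one_le algebra_simps)
  next
    case False
    then have c: "\<bar>g \<bullet> q\<bar> / (norm g * norm q) \<le> k1" "norm g \<le> k2 * norm q"
      and beq: "b = - ((g \<bullet> R q) / (q \<bullet> R q))"
      using b unfolding cg_coeff_def by (auto split: if_splits)
    \<comment> \<open>For q = 0 the quotient defining \<open>b\<close> would be 0/0 = 0.\<close>
    have q0: "q \<noteq> 0" using False beq linear_0[OF R] by auto
    then have nq: "0 < norm q" by simp
    have gq1: "\<bar>g \<bullet> q\<bar> \<le> k1 * (norm g * norm q)"
      using c(1) nq by (cases "g = 0") (simp_all add: pos_divide_le_eq)
    have qR: "0 < (1 - 4 * \<epsilon>) * p * (norm q)\<^sup>2" using \<epsilon> p nq by simp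
    then have qRq: "0 < q \<bullet> R q" using qq by linarith
    have "\<bar>g \<bullet> R q\<bar> \<le> \<bar>g \<bullet> R q - p * (g \<bullet> q)\<bar> + \<bar>p * (g \<bullet> q)\<bar>" by linarith
    also have "\<dots> \<le> 4 * \<epsilon> * p * (norm g * norm q) + p * (k1 * (norm g * norm q))"
      using p by (intro add_mono gq) (simp add: abs_mult gq1)
    also have "\<dots> = (k1 + 4 * \<epsilon>) * p * norm q * norm g" by (simp add: algebra_simps)
    also have "\<dots> \<le> (k1 + 4 * \<epsilon>) * p * norm q * (k2 * norm q)"
      using k \<epsilon> p by (intro mult_left_mono c(2)) auto
    also have "\<dots> = k2 * (k1 + 4 * \<epsilon>) * (p * (norm q)\<^sup>2)" by (simp add: power2_eq_square mult_ac)
    finally have num: "\<bar>g \<bullet> R q\<bar> \<le> k2 * (k1 + 4 * \<epsilon>) * (p * (norm q)\<^sup>2)" .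
    have "\<bar>b\<bar> = \<bar>g \<bullet> R q\<bar> / (q \<bullet> R q)" using beq qRq by (simp add: abs_divide)
    also have "\<dots> \<le> (k2 * (k1 + 4 * \<epsilon>) * (p * (norm q)\<^sup>2)) / ((1 - 4 * \<epsilon>) * p * (norm q)\<^sup>2)"
      by (rule frac_le[OF _ num qR qq]) (use k \<epsilon> p in auto)
    also have "\<dots> = k2 * (k1 + 4 * \<epsilon>) / (1 - 4 * \<epsilon>)" using p nq by simp
    finally have 1: "\<bar>b\<bar> \<le> k2 * (k1 + 4 * \<epsilon>) / (1 - 4 * \<epsilon>)" .
    have 2: "g \<bullet> R q + b * (q \<bullet> R q) = 0" using qRq by (simp add: beq)
    have "- (\<bar>b\<bar> * \<bar>g \<bullet> q\<bar>) \<le> b * (g \<bullet> q)" by (metis abs_mult abs_ge_minus_self minus_le_iff)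
    moreover have "\<bar>b\<bar> * \<bar>g \<bullet> q\<bar> \<le> \<bar>b\<bar> * (k1 * (norm g * norm q))" by (intro mult_left_mono gq1) simp
    \<comment> \<open>Completing the square absorbs the cross term into b^2 norm(q)^2 at the cost of
      k1^2 norm(g)^2.\<close>
    moreover have "0 \<le> (\<bar>b\<bar> * norm q - k1 * norm g)\<^sup>2" by simp
    then have "2 * (\<bar>b\<bar> * (k1 * (norm g * norm q))) \<le> b\<^sup>2 * (norm q)\<^sup>2 + k1\<^sup>2 * (norm g)\<^sup>2"
      by (simp add: power2_diff power_mult_distrib mult_ac)
    moreover have "(norm (g + b *\<^sub>R q))\<^sup>2 = (norm g)\<^sup>2 + 2 * (b * (g \<bullet> q)) + b\<^sup>2 * (norm q)\<^sup>2"
      unfolding power2_norm_eq_inner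
      by (simp add: inner_add_left inner_add_right inner_commute power2_eq_square)
    ultimately have "(1 - k1\<^sup>2) * (norm g)\<^sup>2 \<le> (norm (g + b *\<^sub>R q))\<^sup>2"
      by (simp add: left_diff_distrib)
    with 1 2 show ?thesis by simp
  qed
  then show "\<bar>b\<bar> \<le> k2 * (k1 + 4 * \<epsilon>) / (1 - 4 * \<epsilon>)"
    and "b * (g \<bullet> R q + b * (q \<bullet> R q)) = 0"
    and "(1 - k1\<^sup>2) * (norm g)\<^sup>2 \<le> (norm (g + b *\<^sub>R q))\<^sup>2" by auto
qed

text \<open>The error of the step combines the part of Y outside the range of P, its image under P
  R, the deviation of P R P from p P and of the step size from 1 / p, and the momentum term b q.
  \<open>D\<close> is the first denominator of \<open>cg_gamma1\<close>; doubled by the truncation,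
  the coefficient of norm Y becomes the first fraction there.\<close>

lemma cg_step:
  fixes P R :: "'t::real_inner \<Rightarrow> 't"
  assumes P: "orth_proj P" and R: "selfadjoint R"
    and rip: "\<And>x. norm (P x - (1 / p) *\<^sub>R P (R (P x))) \<le> 4 * \<epsilon> * norm x"
    and PR: "\<And>x. norm (P (R x)) \<le> \<kappa> * norm x"
    and \<kappa>: "0 \<le> \<kappa>" "\<kappa> * \<eta> \<le> 1 / 2 * \<epsilon> * p" and \<eta>: "\<eta> \<le> 1 / 2 * \<epsilon>"
    and Y: "norm (Y - P Y) \<le> \<eta> * norm Y"
    and p: "0 < p" and \<epsilon>: "0 < \<epsilon>" "1 - 4 * \<epsilon> > 0" and k: "0 \<le> k1" "0 \<le> k2"
    and s: "s = 1 - k1 * (1 + 4 * \<epsilon>)" and D: "D = s - 4 * \<epsilon>" "0 < D"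
    and B: "B = k2 * (k1 + 4 * \<epsilon>) / (1 - 4 * \<epsilon>)"
    and g: "g = P (R Y)" and q: "P q = q" and b: "b = 0 \<or> b = cg_coeff k1 k2 R g q"
    and Q: "Q = g + b *\<^sub>R q" and a: "a = (g \<bullet> P Q) / (P Q \<bullet> R (P Q))"
  shows "norm g \<le> p * (1 + 5 * \<epsilon>) * norm Y"
    and "\<bar>b\<bar> \<le> B"
    and "norm (a *\<^sub>R Q - Y) \<le> (4 * \<epsilon> + 5 * \<epsilon> * s) / D * norm Y + s / (D * p) * (B * norm q)"
proof -
  note pP = orth_projD[OF P]
  interpret P: linear P by (rule pP)
  have linR: "linear R" using R by (rule selfadjoint_linear)
  interpret R: linear R by (rule linR)
  have s0: "0 < s" using D \<epsilon> by simp
  have Pg: "P g = g" by (simp add: g pP(3))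
  have PQ: "P Q = Q" by (simp add: Q P.add P.scale Pg q)
  have rip1: "norm (P (R z) - p *\<^sub>R z) \<le> 4 * \<epsilon> * p * norm z" if z: "P z = z" for z
  proof -
    have "P (R z) - p *\<^sub>R z = - (p *\<^sub>R (P z - (1 / p) *\<^sub>R P (R (P z))))"
      using p by (simp add: z scaleR_diff_right)
    then have "norm (P (R z) - p *\<^sub>R z) = p * norm (P z - (1 / p) *\<^sub>R P (R (P z)))"
      using p by simp
    also have "\<dots> \<le> p * (4 * \<epsilon> * norm z)" using p by (intro mult_left_mono rip) simp
    finally show ?thesis by (simp add: mult_ac)
  qed
  have rip2: "\<bar>w \<bullet> R z - p * (w \<bullet> z)\<bar> \<le> 4 * \<epsilon> * p * (norm w * norm z)"
    if "P z = z" "P w = w" for w z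
  proof -
    have "w \<bullet> R z = w \<bullet> P (R z)" using pP(4)[of w "R z"] that(2) by simp
    then have "w \<bullet> R z - p * (w \<bullet> z) = w \<bullet> (P (R z) - p *\<^sub>R z)" by (simp add: inner_diff_right)
    then have "\<bar>w \<bullet> R z - p * (w \<bullet> z)\<bar> \<le> norm w * norm (P (R z) - p *\<^sub>R z)"
      using Cauchy_Schwarz_ineq2 by simp
    also have "\<dots> \<le> norm w * (4 * \<epsilon> * p * norm z)" by (intro mult_left_mono rip1 that(1)) simp
    finally show ?thesis by (simp add: mult_ac)
  qed
  have rip3: "(1 - 4 * \<epsilon>) * p * (norm z)\<^sup>2 \<le> z \<bullet> R z" if "P z = z" for z
  proof -
    have "p * (norm z)\<^sup>2 - z \<bullet> R z \<le> 4 * \<epsilon> * p * (norm z)\<^sup>2"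
      using rip2[OF that that] by (simp add: abs_le_iff power2_eq_square dot_square_norm)
    then show ?thesis by (simp add: algebra_simps)
  qed
  note coeff = cg_coeff_bound[OF linR rip2[OF q Pg] rip3[OF q] p \<epsilon> k b]
  show bB: "\<bar>b\<bar> \<le> B" using coeff(1) by (simp add: B)
  have PRPY: "norm (P (R (P Y))) \<le> p * (1 + 4 * \<epsilon>) * norm Y"
  proof -
    have "norm (P (R (P Y))) \<le> norm (P (R (P Y)) - p *\<^sub>R P Y) + norm (p *\<^sub>R P Y)"
      by (metis diff_add_cancel norm_triangle_ineq)
    also have "\<dots> \<le> 4 * \<epsilon> * p * norm (P Y) + p * norm (P Y)"
      using p by (intro add_mono rip1 pP) simp
    also have "\<dots> = p * (1 + 4 * \<epsilon>) * norm (P Y)" by (simp add: algebra_simps)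
    also have "\<dots> \<le> p * (1 + 4 * \<epsilon>) * norm Y"
      using p \<epsilon> orth_proj_norm_le(1)[OF P] by (intro mult_left_mono) auto
    finally show ?thesis .
  qed
  have PRn: "norm (P (R (Y - P Y))) \<le> 1 / 2 * \<epsilon> * p * norm Y"
  proof -
    have "norm (P (R (Y - P Y))) \<le> \<kappa> * (\<eta> * norm Y)"
      by (rule order_trans[OF PR mult_left_mono[OF Y \<kappa>(1)]])
    also have "\<dots> \<le> 1 / 2 * \<epsilon> * p * norm Y"
      using mult_right_mono[OF \<kappa>(2), of "norm Y"] by (simp add: mult_ac)
    finally show ?thesis .
  qed
  show "norm g \<le> p * (1 + 5 * \<epsilon>) * norm Y"
  proof -
    have "g = P (R (P Y)) + P (R (Y - P Y))" by (simp add: g R.diff P.diff)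
    then have "norm g \<le> norm (P (R (P Y))) + norm (P (R (Y - P Y)))" by (metis norm_triangle_ineq)
    also have "\<dots> \<le> p * (1 + 4 * \<epsilon>) * norm Y + 1 / 2 * \<epsilon> * p * norm Y" by (intro add_mono PRPY PRn)
    also have "\<dots> = (p * (1 + 4 * \<epsilon>) + 1 / 2 * \<epsilon> * p) * norm Y" by (simp add: algebra_simps)
    also have "\<dots> \<le> p * (1 + 5 * \<epsilon>) * norm Y"
      using p \<epsilon> by (intro mult_right_mono) (simp_all add: algebra_simps)
    finally show ?thesis .
  qed

  have k1: "k1 < 1"
  proof -
    have "k1 * (1 + 4 * \<epsilon>) < 1" using D s \<epsilon> by linarith
    moreover have "k1 * 1 \<le> k1 * (1 + 4 * \<epsilon>)" using k \<epsilon> by (intro mult_left_mono) auto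
    ultimately show ?thesis by simp
  qed
  have gQ: "(1 - k1) * norm g \<le> norm Q"
  proof (rule power2_le_imp_le)
    have "(1 - k1)\<^sup>2 \<le> 1 - k1\<^sup>2"
      using k k1 mult_left_mono[of k1 1 k1] by (simp add: power2_eq_square algebra_simps)
    then have "((1 - k1) * norm g)\<^sup>2 \<le> (1 - k1\<^sup>2) * (norm g)\<^sup>2"
      by (simp add: power_mult_distrib mult_right_mono)
    also have "\<dots> \<le> (norm Q)\<^sup>2" using coeff(3) by (simp add: Q)
    finally show "((1 - k1) * norm g)\<^sup>2 \<le> (norm Q)\<^sup>2" .
  qed simp
  text \<open>A vanishing direction makes \<open>a = 0/0 = 0\<close>; then \<open>1 / p\<close> is an equally good step size.\<close>
  obtain \<alpha> where \<alpha>: "\<alpha> *\<^sub>R Q = a *\<^sub>R Q" "\<bar>1 - \<alpha> * p\<bar> \<le> 4 * \<epsilon> / D"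
  proof (cases "Q = 0")
    case True
    show thesis by (rule that[of "1 / p"]) (use True p \<epsilon> D in simp_all)
  next
    case False
    then have nQ: "0 < norm Q" by simp
    have dpos: "0 < (1 - 4 * \<epsilon>) * p * (norm Q)\<^sup>2" using nQ \<epsilon> p by simp
    have dge: "(1 - 4 * \<epsilon>) * p * (norm Q)\<^sup>2 \<le> Q \<bullet> R Q" by (rule rip3[OF PQ])
    \<comment> \<open>Conjugacy removes the previous direction from the denominator, so 1 - a p
      measures how far <Q, R g> is from p <Q, g>.\<close>
    have QR: "Q \<bullet> R Q = Q \<bullet> R g"
    proof -
      have "Q \<bullet> R Q = Q \<bullet> R g + b * (Q \<bullet> R q)"
        by (subst (2) Q) (simp add: R.add R.scale inner_add_right)
      moreover have "Q \<bullet> R q = g \<bullet> R q + b * (q \<bullet> R q)" by (simp add: Q inner_add_left)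
      ultimately show ?thesis using coeff(2) by simp
    qed
    have "1 - a * p = (Q \<bullet> R g - p * (Q \<bullet> g)) / (Q \<bullet> R Q)"
      using dpos dge by (simp add: a PQ QR[symmetric] diff_divide_distrib inner_commute mult_ac)
    then have "\<bar>1 - a * p\<bar> = \<bar>Q \<bullet> R g - p * (Q \<bullet> g)\<bar> / (Q \<bullet> R Q)"
      using dpos dge by (simp add: abs_divide)
    also have "\<dots> \<le> (4 * \<epsilon> * p * (norm Q * norm g)) / ((1 - 4 * \<epsilon>) * p * (norm Q)\<^sup>2)"
      by (rule frac_le[OF _ rip2[OF Pg PQ] dpos dge]) (use \<epsilon> p in auto)
    also have "\<dots> = 4 * \<epsilon> * norm g / ((1 - 4 * \<epsilon>) * norm Q)"
      using p nQ by (simp add: power2_eq_square)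
    also have "\<dots> \<le> 4 * \<epsilon> / D"
    proof -
      \<comment> \<open>The two sides differ by 8 k1 \<epsilon>; the weaker denominator
        \<open>D\<close> is the one in \<open>cg_gamma1\<close>.\<close>
      have "D \<le> (1 - 4 * \<epsilon>) * (1 - k1)" using k \<epsilon> by (simp add: D s algebra_simps)
      then have "D * norm g \<le> (1 - 4 * \<epsilon>) * (1 - k1) * norm g" by (rule mult_right_mono) simp
      also have "\<dots> \<le> (1 - 4 * \<epsilon>) * norm Q"
        using mult_left_mono[OF gQ, of "1 - 4 * \<epsilon>"] \<epsilon> by (simp add: mult.assoc)
      finally have "4 * \<epsilon> * (D * norm g) \<le> 4 * \<epsilon> * ((1 - 4 * \<epsilon>) * norm Q)"
        using \<epsilon> by (intro mult_left_mono) auto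
      then show ?thesis using D nQ \<epsilon> by (simp add: divide_le_eq le_divide_eq mult_ac)
    qed
    finally show thesis by (intro that[of a]) auto
  qed
  have \<alpha>p: "\<bar>\<alpha>\<bar> * p \<le> s / D"
  proof -
    have "\<bar>\<alpha>\<bar> * p = \<bar>\<alpha> * p\<bar>" using p by (simp add: abs_mult)
    also have "\<dots> \<le> 1 + \<bar>1 - \<alpha> * p\<bar>" by linarith
    also have "\<dots> \<le> 1 + 4 * \<epsilon> / D" using \<alpha> by simp
    also have "\<dots> = s / D" using D by (simp add: field_simps)
    finally show ?thesis .
  qed
  \<comment> \<open>The factor s / D is at least 1; inserting it lets this term and
    \<open>t3\<close> add up to s / D * \<epsilon> * norm Y.\<close>
  have t1: "norm (Y - P Y) \<le> s / D * (1 / 2 * \<epsilon> * norm Y)"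
  proof -
    have "norm (Y - P Y) \<le> 1 * (1 / 2 * \<epsilon> * norm Y)"
      using order_trans[OF Y mult_right_mono[OF \<eta> norm_ge_zero]] by simp
    also have "\<dots> \<le> s / D * (1 / 2 * \<epsilon> * norm Y)"
      using D \<epsilon> by (intro mult_right_mono) simp_all
    finally show ?thesis .
  qed
  have t2: "norm (P Y - \<alpha> *\<^sub>R P (R (P Y))) \<le> (4 * \<epsilon> + 4 * \<epsilon> / D * (1 + 4 * \<epsilon>)) * norm Y"
  proof -
    have "P Y - \<alpha> *\<^sub>R P (R (P Y))
        = (P Y - (1 / p) *\<^sub>R P (R (P Y))) + (1 / p * (1 - \<alpha> * p)) *\<^sub>R P (R (P Y))"
      using p by (simp add: right_diff_distrib scaleR_diff_left)
    also have "norm \<dots> \<le> norm (P Y - (1 / p) *\<^sub>R P (R (P Y)))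
        + norm ((1 / p * (1 - \<alpha> * p)) *\<^sub>R P (R (P Y)))"
      by (rule norm_triangle_ineq)
    also have "norm ((1 / p * (1 - \<alpha> * p)) *\<^sub>R P (R (P Y))) = \<bar>1 - \<alpha> * p\<bar> * (norm (P (R (P Y))) / p)"
      using p by (simp add: abs_mult)
    also have "norm (P Y - (1 / p) *\<^sub>R P (R (P Y))) + \<bar>1 - \<alpha> * p\<bar> * (norm (P (R (P Y))) / p)
        \<le> 4 * \<epsilon> * norm Y + 4 * \<epsilon> / D * ((1 + 4 * \<epsilon>) * norm Y)"
      using p D \<epsilon> PRPY by (intro add_mono rip mult_mono \<alpha>(2)) (auto simp: pos_divide_le_eq mult_ac)
    finally show ?thesis by (simp add: algebra_simps add_divide_distrib)
  qed
  have t3: "norm (\<alpha> *\<^sub>R P (R (Y - P Y))) \<le> s / D * (1 / 2 * \<epsilon> * norm Y)"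
  proof -
    have "norm (\<alpha> *\<^sub>R P (R (Y - P Y))) \<le> \<bar>\<alpha>\<bar> * (1 / 2 * \<epsilon> * p * norm Y)"
      unfolding norm_scaleR by (intro mult_left_mono PRn) simp
    also have "\<dots> = (\<bar>\<alpha>\<bar> * p) * (1 / 2 * \<epsilon> * norm Y)" by simp
    also have "\<dots> \<le> s / D * (1 / 2 * \<epsilon> * norm Y)" using \<epsilon> by (intro mult_right_mono \<alpha>p) simp
    finally show ?thesis .
  qed
  have t4: "norm ((\<alpha> * b) *\<^sub>R q) \<le> s / (D * p) * (B * norm q)"
  proof -
    have "\<bar>\<alpha>\<bar> \<le> s / (D * p)" using \<alpha>p p D by (simp add: pos_le_divide_eq mult_ac)
    then have "\<bar>\<alpha>\<bar> * (\<bar>b\<bar> * norm q) \<le> s / (D * p) * (B * norm q)"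
      using bB s0 D p by (intro mult_mono mult_right_mono) auto
    then show ?thesis by (simp add: abs_mult mult.assoc)
  qed
  have "a *\<^sub>R Q - Y = \<alpha> *\<^sub>R P (R (Y - P Y)) + (\<alpha> * b) *\<^sub>R q
      - ((Y - P Y) + (P Y - \<alpha> *\<^sub>R P (R (P Y))))"
    unfolding \<alpha>(1)[symmetric] unfolding Q g by (simp add: R.diff P.diff scaleR_add_right scaleR_diff_right)
  also have "norm \<dots> \<le> (norm (\<alpha> *\<^sub>R P (R (Y - P Y))) + norm ((\<alpha> * b) *\<^sub>R q))
      + (norm (Y - P Y) + norm (P Y - \<alpha> *\<^sub>R P (R (P Y))))"
    by (intro order_trans[OF norm_triangle_ineq4] add_mono norm_triangle_ineq)
  also have "\<dots> \<le> (s / D * (1 / 2 * \<epsilon> * norm Y) + s / (D * p) * (B * norm q))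
      + (s / D * (1 / 2 * \<epsilon> * norm Y) + (4 * \<epsilon> + 4 * \<epsilon> / D * (1 + 4 * \<epsilon>)) * norm Y)"
    by (intro add_mono t1 t2 t3 t4)
  also have "\<dots> = (s / D * \<epsilon> + 4 * \<epsilon> + 4 * \<epsilon> / D * (1 + 4 * \<epsilon>)) * norm Y + s / (D * p) * (B * norm q)"
    by (simp add: algebra_simps)
  also have "s / D * \<epsilon> + 4 * \<epsilon> + 4 * \<epsilon> / D * (1 + 4 * \<epsilon>) = (4 * \<epsilon> + 5 * \<epsilon> * s) / D"
  proof -
    have "s / D * \<epsilon> + 4 * \<epsilon> + 4 * \<epsilon> / D * (1 + 4 * \<epsilon>)
        = (s * \<epsilon> + 4 * \<epsilon> * D + 4 * \<epsilon> * (1 + 4 * \<epsilon>)) / D"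
      using D(2) by (simp add: add_divide_distrib)
    also have "s * \<epsilon> + 4 * \<epsilon> * D + 4 * \<epsilon> * (1 + 4 * \<epsilon>) = 4 * \<epsilon> + 5 * \<epsilon> * s"
      unfolding D(1) by (simp add: algebra_simps)
    finally show ?thesis .
  qed
  finally show "norm (a *\<^sub>R Q - Y) \<le> (4 * \<epsilon> + 5 * \<epsilon> * s) / D * norm Y + s / (D * p) * (B * norm q)" .
qed

text \<open>\<open>c l\<close> majorizes the accumulated contribution \<open>\<Sum>j<l. B ^ (l - j) * e j\<close> of the old search
  directions; at the rate \<open>v\<close> this sum is at most \<open>B / (v - B) * v ^ l * e 0\<close>.\<close>

lemma momentum_recursion:
  fixes e c :: "nat \<Rightarrow> real"
  assumes e: "\<And>l. e (Suc l) \<le> \<tau> * e l + (2 + \<tau>) * c l" and c0: "c 0 \<le> 0"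
    and c: "\<And>l. c (Suc l) \<le> B * (c l + e l)" and e0: "0 \<le> e 0"
    and \<tau>: "0 \<le> \<tau>" and B: "0 \<le> B" "B < v" and v: "v\<^sup>2 = (\<tau> + B) * v + 2 * B"
  shows "e l \<le> v ^ l * e 0"
proof -
  have "e l \<le> v ^ l * e 0 \<and> c l \<le> B / (v - B) * (v ^ l * e 0)"
  proof (induction l)
    case 0
    have "c 0 \<le> B / (v - B) * (v ^ 0 * e 0)"
      using B e0 by (intro order_trans[OF c0] mult_nonneg_nonneg) auto
    then show ?case by simp
  next
    case (Suc l)
    have "e (Suc l) \<le> \<tau> * (v ^ l * e 0) + (2 + \<tau>) * (B / (v - B) * (v ^ l * e 0))"
      by (intro order_trans[OF e] add_mono mult_left_mono) (use Suc \<tau> in auto)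
    also have "\<dots> = (\<tau> + (2 + \<tau>) * (B / (v - B))) * (v ^ l * e 0)" by (simp add: algebra_simps)
    \<comment> \<open>Clearing the denominator v - B gives exactly the quadratic equation assumed
      for \<open>v\<close>.\<close>
    also have "\<tau> + (2 + \<tau>) * (B / (v - B)) = v"
      using B v by (simp add: field_simps power2_eq_square)
    finally have 1: "e (Suc l) \<le> v ^ Suc l * e 0" by (simp add: mult_ac)
    have "c (Suc l) \<le> B * (B / (v - B) * (v ^ l * e 0) + v ^ l * e 0)"
      by (intro order_trans[OF c] add_mono mult_left_mono) (use Suc B in auto)
    also have "\<dots> = B * (B / (v - B) + 1) * (v ^ l * e 0)" by (simp add: algebra_simps)
    also have "B * (B / (v - B) + 1) = B / (v - B) * v" using B by (simp add: field_simps)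
    finally show ?case using 1 by (simp add: mult_ac)
  qed
  then show ?thesis by blast
qed

section \<open>The rate as the positive root of a quadratic equation\<close>

lemma quadratic_root_lt_1:
  fixes x y :: real
  assumes "0 \<le> y" "x + y < 1"
  shows "(x + sqrt (x\<^sup>2 + 4 * y)) / 2 < 1"
proof -
  \<comment> \<open>After expansion this is exactly x + y < 1.\<close>
  have "x\<^sup>2 + 4 * y < (2 - x)\<^sup>2" using assms by (simp add: power2_eq_square algebra_simps)
  then have "sqrt (x\<^sup>2 + 4 * y) < 2 - x" using assms by (intro real_less_lsqrt) auto
  then show ?thesis by simp
qed

lemma quadratic_root_eq:
  fixes x y :: real
  assumes "0 \<le> y"
  shows "((x + sqrt (x\<^sup>2 + 4 * y)) / 2)\<^sup>2 = x * ((x + sqrt (x\<^sup>2 + 4 * y)) / 2) + y"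
proof -
  have "(sqrt (x\<^sup>2 + 4 * y))\<^sup>2 = x\<^sup>2 + 4 * y" using assms by simp
  then show ?thesis by (simp add: power2_eq_square field_simps)
qed

text \<open>The two summands are \<tau> and B of the error recursion, since 18 = 8 + 10.\<close>

lemma cg_gamma1_eq:
  "cg_gamma1 k1 k2 \<epsilon>
     = (8 * \<epsilon> + 10 * \<epsilon> * (1 - k1 * (1 + 4 * \<epsilon>))) / ((1 - k1 * (1 + 4 * \<epsilon>)) - 4 * \<epsilon>)
       + k2 * (k1 + 4 * \<epsilon>) / (1 - 4 * \<epsilon>)"
  unfolding cg_gamma1_def by (intro arg_cong2[of _ _ _ _ plus] arg_cong2[of _ _ _ _ divide])
    (simp_all add: algebra_simps)

lemma cg_gamma2_eq: "cg_gamma2 k1 k2 \<epsilon> = 2 * (k2 * (k1 + 4 * \<epsilon>) / (1 - 4 * \<epsilon>))"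
  unfolding cg_gamma2_def times_divide_eq_right
  by (intro arg_cong2[of _ _ _ _ divide]) (simp_all add: algebra_simps)

text \<open>The geometric estimates reduce the method to the scalar recursion of
  \<open>momentum_recursion\<close>. Here \<rho> stands for 10/3 \<beta> log n, which turns the
  closeness hypothesis into the form that \<open>rip_transfer\<close> uses.\<close>

lemma rtrcgd_convergence:
  fixes X :: "('a::finite, 'b::finite, 'c::{finite,linorder}) tensor"
    and U :: "('a, 'r::{finite,linorder}, 'c) tensor"
    and Us :: "nat \<Rightarrow> ('a, 'r, 'c) tensor"
    and \<Omega> :: "('a \<times> 'b \<times> 'c) list"
  assumes svd: "skinny_tcsvd r X U S V"
    and run: "rtrcgd_run r k1 k2 \<Omega> X Xs Us Ss Vs Qs"
    and k: "0 \<le> k1" "0 \<le> k2" and \<epsilon>: "0 < \<epsilon>" "1 - 4 * \<epsilon> > 0"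
    and D: "0 < (1 - 4 * \<epsilon>) - k1 * (1 + 4 * \<epsilon>)"
    and p: "0 < p" "p \<le> \<rho>" and \<rho>: "2 \<le> \<rho>"
    and R_le: "\<And>Z. norm (sampling_op \<Omega> Z :: ('a, 'b, 'c) tensor) \<le> \<rho> * norm Z"
    and rip: "\<And>Z. norm (tangent_proj U V Z
               - (1 / p) *\<^sub>R tangent_proj U V (sampling_op \<Omega> (tangent_proj U V Z))) \<le> \<epsilon> * norm Z"
    and near: "\<And>l. norm (Xs l - X) / sigma_min X \<le> sqrt p * \<epsilon> / (2 * (1 + \<epsilon>) * \<rho>)"
  shows "norm (Xs l - X) \<le> cg_rate k1 k2 \<epsilon> ^ l * norm (Xs 0 - X)"
proof -
  define s where "s = 1 - k1 * (1 + 4 * \<epsilon>)"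
  define D where "D = s - 4 * \<epsilon>"
  define B where "B = k2 * (k1 + 4 * \<epsilon>) / (1 - 4 * \<epsilon>)"
  define \<tau> where "\<tau> = (8 * \<epsilon> + 10 * \<epsilon> * s) / D"
  define v where "v = cg_rate k1 k2 \<epsilon>"
  define R :: "('a, 'b, 'c) tensor \<Rightarrow> ('a, 'b, 'c) tensor" where "R = sampling_op \<Omega>"
  define P where "P l = tangent_proj (Us l) (Vs l)" for l
  define g where "g l = P l (R (X - Xs l))" for l
  define q where "q l = P l (case l of 0 \<Rightarrow> 0 | Suc l' \<Rightarrow> Qs l')" for l
  define b where "b l = (if l = 0 then 0 else cg_coeff k1 k2 R (g l) (q l))" for l
  define a where "a l = (g l \<bullet> P l (Qs l)) / (P l (Qs l) \<bullet> R (P l (Qs l)))" for l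
  have D0: "0 < D" using D by (simp add: D_def s_def)
  then have s0: "0 < s" using \<epsilon> by (simp add: D_def)
  have B0: "0 \<le> B" using k \<epsilon> by (simp add: B_def)
  have \<tau>0: "0 < \<tau>" using s0 D0 \<epsilon> by (simp add: \<tau>_def add_pos_pos)
  have svds: "skinny_tcsvd r (Xs l) (Us l) (Ss l) (Vs l)" for l
    using run unfolding rtrcgd_run_def by blast
  have Qs: "Qs l = g l + b l *\<^sub>R q l"
    and trunc: "is_tcsvd_truncation r (Xs l + a l *\<^sub>R Qs l) (Xs (Suc l))" for l
    using run unfolding rtrcgd_run_def Let_def a_def b_def g_def q_def P_def R_def by blast+
  note oP' = orth_proj_tangent_proj[OF svd] and oP = orth_proj_tangent_proj[OF svds, folded P_def]
  have selfadj: "selfadjoint R" and psd: "\<And>Z. 0 \<le> Z \<bullet> R Z"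
    unfolding R_def by (rule selfadjoint_sampling_op, rule sampling_op_psd)
  define \<eta> where "\<eta> l = norm (Xs l - X) / sigma_min X" for l
  have \<eta>0: "0 \<le> \<eta> l" for l using sigma_min_bound(1)[OF svd] by (simp add: \<eta>_def)
  have \<eta>_le: "\<eta> l \<le> sqrt p * \<epsilon> / (2 * (1 + \<epsilon>) * \<rho>)" for l unfolding \<eta>_def by (rule near)
  \<comment> \<open>With p \<le> \<rho> and \<rho> at least 1, the closeness bound falls below
    \<epsilon> / (2 (1 + \<epsilon>)), hence below 1 as the perturbation bounds require.\<close>
  have "sqrt p \<le> \<rho>"
  proof (rule power2_le_imp_le)
    have "\<rho> * 1 \<le> \<rho> * \<rho>" using \<rho> by (intro mult_left_mono) auto
    then have "p \<le> \<rho> * \<rho>" using p(2) by linarith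
    then show "(sqrt p)\<^sup>2 \<le> \<rho>\<^sup>2" using p(1) by (simp add: power2_eq_square[of \<rho>])
  qed (use \<rho> in simp)
  then have "sqrt p * \<epsilon> / (2 * (1 + \<epsilon>) * \<rho>) \<le> \<rho> * \<epsilon> / (2 * (1 + \<epsilon>) * \<rho>)"
    using \<epsilon> \<rho> by (intro divide_right_mono mult_right_mono) auto
  also have "\<dots> = \<epsilon> / (2 * (1 + \<epsilon>))" using \<rho> by simp
  also have "\<dots> < 1" using \<epsilon> by (simp add: divide_less_eq)
  finally have \<eta>1: "\<eta> l < 1" for l using \<eta>_le[of l] by linarith
  have pert: "norm (P l Z - tangent_proj U V Z) \<le> 2 * \<eta> l * norm Z"
    "norm ((X - Xs l) - P l (X - Xs l)) \<le> \<eta> l * norm (X - Xs l)" for l Z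
    unfolding P_def \<eta>_def
    by (rule tangent_proj_perturbation[OF svd svds], rule \<eta>1[unfolded \<eta>_def])+

  have step: "norm (g l) \<le> p * (1 + 5 * \<epsilon>) * norm (X - Xs l)" (is ?G)
    "\<bar>b l\<bar> \<le> B" (is ?B)
    "norm (a l *\<^sub>R Qs l - (X - Xs l))
      \<le> (4 * \<epsilon> + 5 * \<epsilon> * s) / D * norm (X - Xs l) + s / (D * p) * (B * norm (q l))" (is ?S) for l
  proof -
    have \<epsilon>': "\<epsilon> < 1 / 4" using \<epsilon> by simp
    note tr = rip_transfer[OF oP oP' selfadj psd R_le[folded R_def] \<rho> p \<epsilon>(1) \<epsilon>' rip[folded R_def]
        pert(1) \<eta>0 \<eta>_le]
    obtain \<kappa> where \<kappa>: "0 \<le> \<kappa>" "\<And>Z. norm (P l (R Z)) \<le> \<kappa> * norm Z"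
      "\<kappa> * \<eta> l \<le> 1 / 2 * \<epsilon> * p" "\<eta> l \<le> 1 / 2 * \<epsilon>"
      using tr(2)[of l] by blast
    have qP: "P l (q l) = q l" unfolding q_def by (rule orth_projD(3)[OF oP])
    have bc: "b l = 0 \<or> b l = cg_coeff k1 k2 R (g l) (q l)" by (simp add: b_def)
    note cg = cg_step[OF oP selfadj tr(1) \<kappa>(2) \<kappa>(1) \<kappa>(3) \<kappa>(4) pert(2) p(1) \<epsilon> k s_def D_def D0 B_def
        g_def qP bc Qs a_def]
    show ?G ?B ?S by (rule cg)+
  qed

  define e where "e l = norm (Xs l - X)" for l
  \<comment> \<open>Dividing by p (1 + 5 \<epsilon>), the factor in the gradient bound, makes each
    new gradient contribute at most e l.\<close>
  define c where "c l = B * norm (q l) / (p * (1 + 5 * \<epsilon>))" for l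
  have e_eq: "norm (X - Xs l) = e l" for l by (simp add: e_def norm_minus_commute)
  have pe: "0 < p * (1 + 5 * \<epsilon>)" using p \<epsilon> by simp
  have bq: "B * norm (q l) = p * (1 + 5 * \<epsilon>) * c l" for l
    by (simp only: c_def times_divide_eq_right
        nonzero_mult_div_cancel_left[OF pe[THEN less_imp_neq, THEN not_sym]])
  have "e l \<le> v ^ l * e 0"
  proof (rule momentum_recursion)
    fix l
    have "e (Suc l) \<le> 2 * norm (a l *\<^sub>R Qs l - (X - Xs l))"
      using tcsvd_truncation_error[OF svd trunc, of l] by (simp add: e_def algebra_simps)
    also have "\<dots> \<le> 2 * ((4 * \<epsilon> + 5 * \<epsilon> * s) / D * e l + s / (D * p) * (B * norm (q l)))"
      using step(3)[of l] by (simp only: e_eq mult_le_cancel_left_pos zero_less_numeral)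
    also note bq
    also have "s / (D * p) * (p * (1 + 5 * \<epsilon>) * c l) = s * (1 + 5 * \<epsilon>) / D * c l"
      using p by simp
    also have "2 * ((4 * \<epsilon> + 5 * \<epsilon> * s) / D * e l + s * (1 + 5 * \<epsilon>) / D * c l)
        = \<tau> * e l + 2 * s * (1 + 5 * \<epsilon>) / D * c l"
    proof -
      have "\<tau> = 2 * ((4 * \<epsilon> + 5 * \<epsilon> * s) / D)" by (simp add: \<tau>_def)
      moreover have "2 * (x * e l + y / D * c l) = 2 * x * e l + 2 * y / D * c l" for x y
        by (simp add: distrib_left)
      ultimately show ?thesis by (simp only: mult.assoc)
    qed
    \<comment> \<open>With this normalization the momentum coefficient is exactly 2 + \<tau>, as the
      recursion demands.\<close>
    also have "2 * s * (1 + 5 * \<epsilon>) / D = 2 + \<tau>"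
    proof -
      have "2 + \<tau> = (2 * D + (8 * \<epsilon> + 10 * \<epsilon> * s)) / D"
        using D0 by (simp add: \<tau>_def add_divide_distrib)
      also have "2 * D + (8 * \<epsilon> + 10 * \<epsilon> * s) = 2 * s * (1 + 5 * \<epsilon>)"
        by (simp add: D_def algebra_simps)
      finally show ?thesis by simp
    qed
    finally show "e (Suc l) \<le> \<tau> * e l + (2 + \<tau>) * c l" .
    \<comment> \<open>Projecting the old direction onto the new tangent space does not lengthen
      it.\<close>
    have "norm (q (Suc l)) \<le> norm (Qs l)"
      unfolding q_def by (simp add: orth_proj_norm_le(1)[OF oP])
    also have "\<dots> \<le> norm (g l) + \<bar>b l\<bar> * norm (q l)"
      using norm_triangle_ineq[of "g l" "b l *\<^sub>R q l"] by (simp add: Qs)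
    also have "\<dots> \<le> p * (1 + 5 * \<epsilon>) * e l + B * norm (q l)"
      using step(1,2)[of l] by (intro add_mono mult_right_mono) (simp_all add: e_eq)
    also have "\<dots> = p * (1 + 5 * \<epsilon>) * (c l + e l)"
      unfolding bq by (simp add: distrib_left)
    finally have "B * norm (q (Suc l)) \<le> B * (p * (1 + 5 * \<epsilon>) * (c l + e l))"
      by (rule mult_left_mono[OF _ B0])
    then show "c (Suc l) \<le> B * (c l + e l)"
      unfolding c_def[of "Suc l"] using pe by (simp add: pos_divide_le_eq mult_ac)
  next
    have "q 0 = 0" unfolding q_def using linear_0[OF orth_projD(2)[OF oP]] by simp
    then show "c 0 \<le> 0" by (simp add: c_def)
    show "0 \<le> e 0" by (simp add: e_def)
    show "0 \<le> \<tau>" "0 \<le> B" using \<tau>0 B0 by simp_all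
    have \<gamma>: "cg_gamma1 k1 k2 \<epsilon> = \<tau> + B" "cg_gamma2 k1 k2 \<epsilon> = 2 * B"
      by (simp_all only: cg_gamma1_eq cg_gamma2_eq \<tau>_def D_def s_def B_def)
    \<comment> \<open>The square root is at least \<gamma>1 = \<tau> + B, so v is at least \<tau> +
      B and exceeds B.\<close>
    have "\<tau> + B \<le> sqrt ((\<tau> + B)\<^sup>2 + 4 * (2 * B))"
      by (rule real_le_rsqrt) (simp add: B0)
    then show "B < v" using \<tau>0 by (simp add: v_def cg_rate_def \<gamma>)
    show "v\<^sup>2 = (\<tau> + B) * v + 2 * B"
      unfolding v_def cg_rate_def \<gamma> by (rule quadratic_root_eq) (simp add: B0)
  qed
  then show ?thesis by (simp only: e_def v_def)
qed

section \<open>The constants for small \<epsilon>, and the theorem\<close>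

lemma cg_gamma_tendsto:
  assumes "k1 \<noteq> 1"
  shows "((\<lambda>\<epsilon>. cg_gamma1 k1 k2 \<epsilon> + cg_gamma2 k1 k2 \<epsilon>) \<longlongrightarrow> 3 * k1 * k2) (at 0)"
proof -
  have "((\<lambda>\<epsilon>. cg_gamma1 k1 k2 \<epsilon> + cg_gamma2 k1 k2 \<epsilon>)
      \<longlongrightarrow> (18 * 0 - 10 * k1 * 0 * (1 + 4 * 0)) / ((1 - 4 * 0) - k1 * (1 + 4 * 0))
        + (4 * k2 * 0 + k1 * k2) / (1 - 4 * 0) + (8 * k2 * 0 + 2 * k1 * k2) / (1 - 4 * 0)) (at 0)"
    unfolding cg_gamma1_def cg_gamma2_def by (intro tendsto_intros) (use assms in auto)
  then show ?thesis by (simp add: mult.assoc)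
qed

text \<open>The restart constants are nonnegative and the denominators of \<gamma>1 and \<gamma>2
  positive as explicit hypotheses. Membership of \<Omega> in the support of the sampling law fixes
  its length to \<open>m\<close>, which ties \<open>p\<close> to the operator norm; given the three
  bounds, the argument is deterministic.\<close>

theorem theorem3p7:
  fixes X :: "('a::finite, 'b::finite, 'c::{finite,linorder}) tensor"
    and U :: "('a, 'r::{finite,linorder}, 'c) tensor"
    and S :: "('r, 'r, 'c) tensor"
    and V :: "('b, 'r, 'c) tensor"
    and r :: "'c \<Rightarrow> nat"
    and \<Omega> :: "('a \<times> 'b \<times> 'c) list"
    and m n :: nat
    and p k1 k2 \<beta> \<epsilon>\<^sub>0 :: real
    and Xs Qs :: "nat \<Rightarrow> ('a, 'b, 'c) tensor"
    and Us :: "nat \<Rightarrow> ('a, 'r, 'c) tensor"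
    and Ss :: "nat \<Rightarrow> ('r, 'r, 'c) tensor"
    and Vs :: "nat \<Rightarrow> ('b, 'r, 'c) tensor"
  shows
    "(trank X = r \<longrightarrow>
      n = Max {CARD('a), CARD('b), CARD('c)} \<longrightarrow>
      \<Omega> \<in> set_pmf (uniform_samples m) \<longrightarrow>
      p = real m / real (CARD('a) * CARD('b) * CARD('c)) \<longrightarrow>
      skinny_tcsvd r X U S V \<longrightarrow>
      0 \<le> k1 \<longrightarrow> 0 \<le> k2 \<longrightarrow>
      rtrcgd_run r k1 k2 \<Omega> X Xs Us Ss Vs Qs \<longrightarrow>
      \<beta> > 1 \<longrightarrow> \<epsilon>\<^sub>0 > 0 \<longrightarrow>
      1 - 4 * \<epsilon>\<^sub>0 > 0 \<longrightarrow> (1 - 4 * \<epsilon>\<^sub>0) - k1 * (1 + 4 * \<epsilon>\<^sub>0) > 0 \<longrightarrow>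
      cg_gamma1 k1 k2 \<epsilon>\<^sub>0 + cg_gamma2 k1 k2 \<epsilon>\<^sub>0 < 1 \<longrightarrow>
      onorm (sampling_op \<Omega> :: ('a, 'b, 'c) tensor \<Rightarrow> ('a, 'b, 'c) tensor) \<le> 10 / 3 * \<beta> * ln (real n) \<longrightarrow>
      onorm (\<lambda>Z. tangent_proj U V Z
               - (1 / p) *\<^sub>R tangent_proj U V (sampling_op \<Omega> (tangent_proj U V Z))) \<le> \<epsilon>\<^sub>0 \<longrightarrow>
      (\<forall>l. norm (Xs l - X) / sigma_min X \<le> 3 * sqrt p * \<epsilon>\<^sub>0 / (20 * \<beta> * (1 + \<epsilon>\<^sub>0) * ln (real n))) \<longrightarrow>
      cg_rate k1 k2 \<epsilon>\<^sub>0 < 1 \<and>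
      (\<forall>l. norm (Xs l - X) \<le> cg_rate k1 k2 \<epsilon>\<^sub>0 ^ l * norm (Xs 0 - X)))
     \<and>
     (\<forall>\<epsilon>. \<epsilon> > 0 \<and> 1 - 4 * \<epsilon> > 0 \<and> cg_gamma1 0 0 \<epsilon> + cg_gamma2 0 0 \<epsilon> < 1 \<longrightarrow>
        cg_rate 0 0 \<epsilon> = 18 * \<epsilon> / (1 - 4 * \<epsilon>) \<and> 18 * \<epsilon> / (1 - 4 * \<epsilon>) < 1)
     \<and>
     (\<forall>\<kappa>1 \<kappa>2. \<kappa>1 \<noteq> 1 \<longrightarrow>
        ((\<lambda>\<epsilon>. cg_gamma1 \<kappa>1 \<kappa>2 \<epsilon> + cg_gamma2 \<kappa>1 \<kappa>2 \<epsilon>) \<longlongrightarrow> 3 * \<kappa>1 * \<kappa>2) (at 0))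
     \<and>
     (\<forall>\<kappa>1 \<kappa>2. \<kappa>1 \<noteq> 1 \<and> \<kappa>1 * \<kappa>2 < 1 / 3 \<longrightarrow>
        (\<forall>\<^sub>F \<epsilon> in at_right 0. cg_gamma1 \<kappa>1 \<kappa>2 \<epsilon> + cg_gamma2 \<kappa>1 \<kappa>2 \<epsilon> < 1))
     \<and>
     (\<forall>\<epsilon>. 0 < \<epsilon> \<and> \<epsilon> \<le> 0.01 \<longrightarrow> cg_gamma1 0.1 1 \<epsilon> + cg_gamma2 0.1 1 \<epsilon> < 1)"
proof (intro conjI impI allI)
  assume r: "trank X = r" and n: "n = Max {CARD('a), CARD('b), CARD('c)}"
    and \<Omega>: "\<Omega> \<in> set_pmf (uniform_samples m)"
    and p: "p = real m / real (CARD('a) * CARD('b) * CARD('c))"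
    and svd: "skinny_tcsvd r X U S V" and k: "0 \<le> k1" "0 \<le> k2"
    and run: "rtrcgd_run r k1 k2 \<Omega> X Xs Us Ss Vs Qs"
    and \<beta>: "\<beta> > 1" and \<epsilon>: "\<epsilon>\<^sub>0 > 0" "1 - 4 * \<epsilon>\<^sub>0 > 0"
    and D: "(1 - 4 * \<epsilon>\<^sub>0) - k1 * (1 + 4 * \<epsilon>\<^sub>0) > 0"
    and \<gamma>: "cg_gamma1 k1 k2 \<epsilon>\<^sub>0 + cg_gamma2 k1 k2 \<epsilon>\<^sub>0 < 1"
    and R: "onorm (sampling_op \<Omega> :: ('a, 'b, 'c) tensor \<Rightarrow> ('a, 'b, 'c) tensor) \<le> 10 / 3 * \<beta> * ln (real n)"
    and rip: "onorm (\<lambda>Z. tangent_proj U V Z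
               - (1 / p) *\<^sub>R tangent_proj U V (sampling_op \<Omega> (tangent_proj U V Z))) \<le> \<epsilon>\<^sub>0"
    and near: "\<forall>l. norm (Xs l - X) / sigma_min X
                 \<le> 3 * sqrt p * \<epsilon>\<^sub>0 / (20 * \<beta> * (1 + \<epsilon>\<^sub>0) * ln (real n))"
  have "0 \<le> cg_gamma2 k1 k2 \<epsilon>\<^sub>0" using k \<epsilon> by (simp add: cg_gamma2_def)
  then show "cg_rate k1 k2 \<epsilon>\<^sub>0 < 1" unfolding cg_rate_def using \<gamma> by (rule quadratic_root_lt_1)
  fix l
  define \<rho> where "\<rho> = 10 / 3 * \<beta> * ln (real n)"
  show "norm (Xs l - X) \<le> cg_rate k1 k2 \<epsilon>\<^sub>0 ^ l * norm (Xs 0 - X)"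
  proof (cases "n = 1 \<or> m = 0")
    \<comment> \<open>Here log n = 0 (with division by zero giving 0) or p = 0. The closeness bound
      is then 0, and every iterate equals X.\<close>
    case True
    have "norm (Xs j - X) \<le> 0" for j
    proof -
      have "norm (Xs j - X) / sigma_min X \<le> 0"
        using spec[OF near, of j] True p by auto
      then show ?thesis using sigma_min_bound(1)[OF svd] by (simp add: divide_le_0_iff)
    qed
    then show ?thesis by simp
  next
    case False
    have "CARD('a) \<le> n" unfolding n by (rule Max_ge) auto
    then have "2 \<le> n" using False zero_less_card_finite[where 'a = 'a] by linarith
    then have "ln 2 \<le> ln (real n)" by simp
    then have ln: "2 / 3 \<le> ln (real n)" using ln2_ge_two_thirds by linarith
    \<comment> \<open>Here log 2 \<ge> 2/3 is enough: 10/3 * 2/3 = 20/9 exceeds 2.\<close>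
    have \<rho>: "2 \<le> \<rho>"
    proof -
      have "1 * (2 / 3) \<le> \<beta> * ln (real n)" using \<beta> ln by (intro mult_mono) auto
      then show ?thesis by (simp add: \<rho>_def)
    qed
    have "length \<Omega> = m" using \<Omega> by (simp add: uniform_samples_def set_replicate_pmf)
    then have p_le: "p \<le> \<rho>"
      using order_trans[OF sampling_density_le_onorm[of \<Omega>] R] unfolding p \<rho>_def by simp
    have p0: "0 < p" using False by (simp add: p)
    let ?R = "sampling_op \<Omega> :: ('a, 'b, 'c) tensor \<Rightarrow> ('a, 'b, 'c) tensor"
    let ?P = "tangent_proj U V"
    have linR: "linear ?R" by (rule selfadjoint_linear[OF selfadjoint_sampling_op])
    have linP: "linear ?P" by (rule orth_projD(2)[OF orth_proj_tangent_proj[OF svd]])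
    have "bounded_linear ?R" using linR linear_conv_bounded_linear by blast
    then have R_le: "norm (?R Z) \<le> \<rho> * norm Z" for Z
      using onorm[of ?R Z] mult_right_mono[OF R norm_ge_zero[of Z]] by (simp add: \<rho>_def)
    have "linear (\<lambda>Z. ?P Z - (1 / p) *\<^sub>R ?P (?R (?P Z)))"
      using linear_compose[OF linear_compose[OF linP linR] linP] linP
      by (intro linear_compose_sub linear_compose_scale_right) (auto simp: o_def)
    then have "bounded_linear (\<lambda>Z. ?P Z - (1 / p) *\<^sub>R ?P (?R (?P Z)))"
      using linear_conv_bounded_linear by blast
    from onorm[OF this] mult_right_mono[OF rip norm_ge_zero]
    have rip': "norm (?P Z - (1 / p) *\<^sub>R ?P (?R (?P Z))) \<le> \<epsilon>\<^sub>0 * norm Z" for Z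
      by (rule order_trans)
    \<comment> \<open>The constant 3/20 is 1 / (2 * 10/3), so the hypothesis is the one of
      \<open>rip_transfer\<close> with \<rho> inserted.\<close>
    have "3 * sqrt p * \<epsilon>\<^sub>0 / (20 * \<beta> * (1 + \<epsilon>\<^sub>0) * ln (real n)) = sqrt p * \<epsilon>\<^sub>0 / (2 * (1 + \<epsilon>\<^sub>0) * \<rho>)"
      using \<beta> \<epsilon> ln by (simp add: \<rho>_def field_simps)
    then have near': "norm (Xs j - X) / sigma_min X \<le> sqrt p * \<epsilon>\<^sub>0 / (2 * (1 + \<epsilon>\<^sub>0) * \<rho>)" for j
      using near by metis
    show ?thesis
      by (rule rtrcgd_convergence[OF svd run k \<epsilon> D p0 p_le \<rho> R_le rip' near'])
  qed
next
  fix \<epsilon> :: real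
  assume \<epsilon>: "\<epsilon> > 0 \<and> 1 - 4 * \<epsilon> > 0 \<and> cg_gamma1 0 0 \<epsilon> + cg_gamma2 0 0 \<epsilon> < 1"
  define x where "x = 18 * \<epsilon> / (1 - 4 * \<epsilon>)"
  have "cg_gamma1 0 0 \<epsilon> = x" "cg_gamma2 0 0 \<epsilon> = 0" "0 \<le> x"
    using \<epsilon> by (simp_all add: cg_gamma1_def cg_gamma2_def x_def)
  then have "cg_rate 0 0 \<epsilon> = x \<and> x < 1" using \<epsilon> by (simp add: cg_rate_def)
  then show "cg_rate 0 0 \<epsilon> = 18 * \<epsilon> / (1 - 4 * \<epsilon>)" "18 * \<epsilon> / (1 - 4 * \<epsilon>) < 1"
    by (simp_all only: x_def)
next
  fix \<kappa>1 \<kappa>2 :: real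
  assume "\<kappa>1 \<noteq> 1"
  then show "((\<lambda>\<epsilon>. cg_gamma1 \<kappa>1 \<kappa>2 \<epsilon> + cg_gamma2 \<kappa>1 \<kappa>2 \<epsilon>) \<longlongrightarrow> 3 * \<kappa>1 * \<kappa>2) (at 0)"
    by (rule cg_gamma_tendsto)
next
  fix \<kappa>1 \<kappa>2 :: real
  assume "\<kappa>1 \<noteq> 1 \<and> \<kappa>1 * \<kappa>2 < 1 / 3"
  then have "\<kappa>1 \<noteq> 1" "3 * \<kappa>1 * \<kappa>2 < 1" by auto
  then show "\<forall>\<^sub>F \<epsilon> in at_right 0. cg_gamma1 \<kappa>1 \<kappa>2 \<epsilon> + cg_gamma2 \<kappa>1 \<kappa>2 \<epsilon> < 1"
    using order_tendstoD(2)[OF tendsto_mono[OF at_le cg_gamma_tendsto]] by blast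
next
  fix \<epsilon> :: real
  assume "0 < \<epsilon> \<and> \<epsilon> \<le> 0.01"
  then have \<epsilon>: "0 < \<epsilon>" "\<epsilon> \<le> 1 / 100" by simp_all
  have "0 \<le> 10 * 0.1 * \<epsilon> * (1 + 4 * \<epsilon>)" using \<epsilon> by simp
  \<comment> \<open>Dropping the negative term leaves numerators that increase with \<epsilon>, so
    1/100 is the worst case; the denominators stay above 0.8 and 0.96, and the three fractions sum
    to less than 0.67.\<close>
  then have "18 * \<epsilon> - 10 * 0.1 * \<epsilon> * (1 + 4 * \<epsilon>) \<le> 18 * \<epsilon> - 0"
    by (intro diff_mono order_refl)
  also have "\<dots> \<le> 0.18" using \<epsilon> by simp
  finally have num: "18 * \<epsilon> - 10 * 0.1 * \<epsilon> * (1 + 4 * \<epsilon>) \<le> 0.18" .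
  have den: "0.8 \<le> (1 - 4 * \<epsilon>) - 0.1 * (1 + 4 * \<epsilon>)" using \<epsilon> by (simp add: field_simps)
  have "cg_gamma1 0.1 1 \<epsilon> + cg_gamma2 0.1 1 \<epsilon> \<le> 0.18 / 0.8 + 0.14 / 0.96 + 0.28 / 0.96"
    unfolding cg_gamma1_def cg_gamma2_def
  proof (intro add_mono)
    show "(18 * \<epsilon> - 10 * 0.1 * \<epsilon> * (1 + 4 * \<epsilon>)) / ((1 - 4 * \<epsilon>) - 0.1 * (1 + 4 * \<epsilon>)) \<le> 0.18 / 0.8"
      by (rule frac_le[OF _ num _ den]) simp_all
    show "(4 * 1 * \<epsilon> + 0.1 * 1) / (1 - 4 * \<epsilon>) \<le> 0.14 / 0.96"
      using \<epsilon> by (intro frac_le) auto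
    show "(8 * 1 * \<epsilon> + 2 * 0.1 * 1) / (1 - 4 * \<epsilon>) \<le> 0.28 / 0.96"
      using \<epsilon> by (intro frac_le) auto
  qed
  then show "cg_gamma1 0.1 1 \<epsilon> + cg_gamma2 0.1 1 \<epsilon> < 1" by simp
qed

end
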